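(* Let $X$ be a compact extremally disconnected space that is a continuous image of $\omega^*$. Then there is a reversible filter $\mathcal{F}$ on $\omega$ such that $K_{\mathcal{F}}$ is a weak $P$-set of $\omega^*$ homeomorphic to $X$.
   Context: Spaces are Hausdorff. A space is extremally disconnected if the closure of every open subset is open. $\beta\omega$ is the Stone space of all ultrafilters on $\omega$ and $\omega^*=\beta\omega\setminus\omega$ is the subspace of free ultrafilters. A closed set $K\subset\omega^*$ is a weak $P$-set of $\omega^*$ if for every countable $D\subset\omega^*\setminus K$ the closure of $D$ in $\omega^*$ is disjoint from $K$. A filter on $\omega$ is a nonempty family of subsets of $\omega$ closed under supersets and finite intersections; all filters on $\omega$ are assumed to contain the Fréchet filter of all cofinite subsets of $\omega$. For a filter $\mathcal{F}$ on $\omega$, $\xi(\mathcal{F})$ is the topological space with underlying set $\omega\cup\{\mathcal{F}\}$ in which every point of $\omega$ is isolated and the neighborhoods of the point $\mathcal{F}$ are the sets $\{\mathcal{F}\}\cup A$ with $A\in\mathcal{F}$. A topological space is reversible if every continuous bijection of the space onto itself is a homeomorphism. A filter $\mathcal{F}$ is reversible if the space $\xi(\mathcal{F})$ is reversible. $K_{\mathcal{F}}=\{p\in\beta\omega:\mathcal{F}\subset p\}$, a closed subset of $\omega^*$, considered with the subspace topology. *)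

theory Defs
  imports "HOL-Analysis.Analysis"
begin

text \<open>
  Filters on \<open>\<omega>\<close> are elements of the library type \<^typ>\<open>nat filter\<close>: a set \<open>A\<close> is a
  member of \<open>F\<close> iff \<^term>\<open>eventually (\<lambda>n. n \<in> A) F\<close>. The library order is reverse
  inclusion of the families of members, so \<open>p \<le> F\<close> means that every member of \<open>F\<close> is
  a member of \<open>p\<close>, and \<open>F \<le> cofinite\<close> means that \<open>F\<close> contains the Frechet filter. The
  improper filter (all subsets of \<open>\<omega>\<close>) is \<open>bot\<close>.
\<close>

definition ultrafilter :: "'a filter \<Rightarrow> bool" where
  "ultrafilter p \<longleftrightarrow>
     p \<noteq> bot \<and> (\<forall>A. eventually (\<lambda>n. n \<in> A) p \<or> eventually (\<lambda>n. n \<notin> A) p)"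

definition beta_omega :: "nat filter topology" where
  "beta_omega = topology_generated_by
     (range (\<lambda>A. {p. ultrafilter p \<and> eventually (\<lambda>n. n \<in> A) p}))"

text \<open>The points of \<open>\<omega>\<close> are identified with the principal ultrafilters.\<close>

definition omega_star :: "nat filter topology" where
  "omega_star = subtopology beta_omega
     (topspace beta_omega - range (\<lambda>n. principal {n}))"

definition K_set :: "nat filter \<Rightarrow> nat filter set" where
  "K_set F = {p \<in> topspace beta_omega. p \<le> F}"

definition extremally_disconnected_space :: "'a topology \<Rightarrow> bool" where
  "extremally_disconnected_space X \<longleftrightarrow>
     (\<forall>U. openin X U \<longrightarrow> openin X (X closure_of U))"

definition weak_P_set :: "'a topology \<Rightarrow> 'a set \<Rightarrow> bool" where
  "weak_P_set X K \<longleftrightarrow> closedin X K \<and>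
     (\<forall>D. countable D \<and> D \<subseteq> topspace X - K \<longrightarrow> (X closure_of D) \<inter> K = {})"

text \<open>
  In \<open>\<xi>(F)\<close> the isolated points of \<open>\<omega>\<close> are the \<open>Some n\<close>; the extra point, called
  \<open>F\<close> itself in the usual description, is \<open>None\<close>.
\<close>

definition xi :: "nat filter \<Rightarrow> nat option topology" where
  "xi F = topology (\<lambda>U. None \<in> U \<longrightarrow> eventually (\<lambda>n. Some n \<in> U) F)"

definition reversible_space :: "'a topology \<Rightarrow> bool" where
  "reversible_space X \<longleftrightarrow>
     (\<forall>f. continuous_map X X f \<and> bij_betw f (topspace X) (topspace X)
          \<longrightarrow> homeomorphic_map X X f)"

definition reversible_filter :: "nat filter \<Rightarrow> bool" where
  "reversible_filter F \<longleftrightarrow> reversible_space (xi F)"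

lemma openin_xi: "openin (xi F) U \<longleftrightarrow> (None \<in> U \<longrightarrow> eventually (\<lambda>n. Some n \<in> U) F)"
proof -
  have "istopology (\<lambda>U. None \<in> U \<longrightarrow> eventually (\<lambda>n. Some n \<in> U) F)"
    unfolding istopology_def
  proof (intro conjI allI impI)
    fix S T :: "nat option set"
    assume "None \<in> S \<longrightarrow> eventually (\<lambda>n. Some n \<in> S) F"
      and "None \<in> T \<longrightarrow> eventually (\<lambda>n. Some n \<in> T) F" and "None \<in> S \<inter> T"
    then show "eventually (\<lambda>n. Some n \<in> S \<inter> T) F"
      by (simp add: eventually_conj_iff)
  next
    fix \<K> :: "nat option set set"
    assume *: "\<forall>K\<in>\<K>. None \<in> K \<longrightarrow> eventually (\<lambda>n. Some n \<in> K) F" and "None \<in> \<Union>\<K>"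
    then obtain K where "K \<in> \<K>" "eventually (\<lambda>n. Some n \<in> K) F" by blast
    then show "eventually (\<lambda>n. Some n \<in> \<Union>\<K>) F"
      by (blast intro: eventually_mono)
  qed
  then show ?thesis
    by (simp add: xi_def topology_inverse')
qed

lemma topspace_xi: "topspace (xi F) = UNIV"
  using openin_subset[of "xi F" UNIV] by (simp add: openin_xi top.extremum_unique)

lemma neighbourhood_xi:
  "(\<exists>U. openin (xi F) U \<and> None \<in> U \<and> U \<subseteq> N) \<longleftrightarrow>
   (\<exists>A. eventually (\<lambda>n. n \<in> A) F \<and> N = insert None (Some ` A))"
proof
  assume "\<exists>U. openin (xi F) U \<and> None \<in> U \<and> U \<subseteq> N"
  then obtain U where U: "eventually (\<lambda>n. Some n \<in> U) F" "None \<in> U" "U \<subseteq> N"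
    by (auto simp: openin_xi)
  have "eventually (\<lambda>n. n \<in> {n. Some n \<in> N}) F"
    using U(1) by (rule eventually_mono) (use U(3) in auto)
  moreover have "N = insert None (Some ` {n. Some n \<in> N})"
  proof (rule set_eqI)
    fix x show "x \<in> N \<longleftrightarrow> x \<in> insert None (Some ` {n. Some n \<in> N})"
      using U by (cases x) auto
  qed
  ultimately show "\<exists>A. eventually (\<lambda>n. n \<in> A) F \<and> N = insert None (Some ` A)"
    by blast
next
  assume "\<exists>A. eventually (\<lambda>n. n \<in> A) F \<and> N = insert None (Some ` A)"
  then obtain A where A: "eventually (\<lambda>n. n \<in> A) F" "N = insert None (Some ` A)"
    by blast
  then have "openin (xi F) N"
    by (simp add: openin_xi image_iff)
  with A show "\<exists>U. openin (xi F) U \<and> None \<in> U \<and> U \<subseteq> N" by blast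
qed

lemma topspace_beta_omega: "topspace beta_omega = {p. ultrafilter p}"
  unfolding beta_omega_def topology_generated_by_topspace
  by (auto intro!: exI[of _ "UNIV :: nat set"])

lemma topspace_omega_star:
  "topspace omega_star = {p. ultrafilter p \<and> p \<notin> range (\<lambda>n. principal {n})}"
  by (auto simp: omega_star_def topspace_beta_omega)

lemma K_set_subset_omega_star:
  assumes "F \<le> cofinite"
  shows "K_set F \<subseteq> topspace omega_star"
proof
  fix p assume p: "p \<in> K_set F"
  have "p \<noteq> principal {n}" for n
  proof
    assume eq: "p = principal {n}"
    have "eventually (\<lambda>m. m \<noteq> n) cofinite"
      by (simp add: eventually_cofinite)
    then have "eventually (\<lambda>m. m \<noteq> n) p"
      using p assms by (auto simp: K_set_def le_filter_def)
    then show False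
      by (simp add: eq eventually_principal)
  qed
  with p show "p \<in> topspace omega_star"
    by (auto simp: K_set_def topspace_omega_star topspace_beta_omega)
qed

end

theory Submission
  imports Defs
begin

text \<open>
  Write \<open>\<omega>\<^sup>*\<close> for the remainder and let \<open>\<phi>\<close> map \<open>\<omega>\<^sup>*\<close> onto \<open>X\<close>. Every clopen \<open>b\<close> of \<open>X\<close> has a code
  \<open>a b \<subseteq> \<omega>\<close>, a set that a free ultrafilter \<open>p\<close> contains iff \<open>\<phi> p \<in> b\<close>. Let \<open>\<pi>\<close> be a
  finite-to-one function on \<open>\<omega>\<close>, call its fibres blocks, and map \<open>\<omega>\<^sup>*\<close> to \<open>X\<close> by
  \<open>\<Psi> p = \<phi> (\<pi> p)\<close>, where \<open>\<pi> p\<close> is the image ultrafilter. The filter \<open>F\<close> is chosen so that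
  \<open>\<Psi>\<close> maps \<open>K\<^sub>F\<close> homeomorphically onto \<open>X\<close>. As \<open>\<Psi>\<close> sees nothing but the blocks, the inside of the
  blocks is free to provide the other two properties.

  \<^emph>\<open>Homeomorphism.\<close> Suppose that each \<open>\<pi> -` a b\<close> with \<open>b \<noteq> {}\<close> is positive for \<open>F\<close>, and that \<open>F\<close>
  is maximal with this property. Then \<open>\<Psi>\<close> maps \<open>K\<^sub>F\<close> onto \<open>X\<close> irreducibly, and an irreducible map
  onto an extremally disconnected space is a homeomorphism. Concretely, every \<open>A \<subseteq> \<omega>\<close> agrees
  modulo \<open>F\<close> with some \<open>\<pi> -` a c\<close> (\<open>every_set_coded\<close>): \<open>c\<close> is the closure, hence open, of the union
  of the clopen sets whose code lies in \<open>A\<close> modulo \<open>F\<close>.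

  \<^emph>\<open>Weak P-set.\<close> This is Kunen's OK-point argument. It suffices that for every decreasing sequence
  \<open>C\<close> of members of \<open>F\<close> there are uncountably many members of \<open>F\<close>, any \<open>n + 1\<close> of which have
  intersection almost contained in \<open>C n\<close> (\<open>weak_P_set_K_set\<close>). These members are produced by a
  transfinite recursion along the continuum (\<open>settling_filter_exists\<close>), in which every sequence
  whose terms can be added to the filter spends one fresh row of an independent linked matrix that
  is built inside the blocks (\<open>linked_matrix_exists\<close>). The same recursion makes \<open>F\<close> maximal: the constant sequence \<open>A\<close>
  either puts \<open>A\<close> into \<open>F\<close> or makes \<open>A\<close> null on some \<open>\<pi> -` a b\<close>, at the cost of finitely many rows.

  \<^emph>\<open>Reversibility.\<close> Let the blocks grow so fast that each cell of the matrix meets the \<open>k\<close>-th block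
  in many more points than all earlier blocks have together. For a permutation \<open>f\<close> of \<open>\<omega>\<close>, few points
  of a block are sent to an earlier block by \<open>f\<close> or by its inverse, so \<open>F\<close> may contain the set of the
  remaining points, for all \<open>f\<close> at once (\<open>cell_independent_block_filter\<close>). If now \<open>q\<close> and \<open>f q\<close> both
  lie in \<open>K\<^sub>F\<close>, then \<open>f\<close> preserves blocks on a member of \<open>q\<close>, whence \<open>\<pi> (f q) = \<pi> q\<close> and
  \<open>\<Psi> (f q) = \<Psi> q\<close>, and \<open>f q = q\<close> because \<open>\<Psi>\<close> is injective on \<open>K\<^sub>F\<close>. So a permutation that maps
  \<open>K\<^sub>F\<close> into itself fixes it pointwise, which is more than reversibility asks for.
\<close>

section \<open>Linked matrices of subsets of the natural numbers\<close>

text \<open>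
  The matrix \<open>A\<close> has rows \<open>i\<close>, and in row \<open>i\<close> the sets \<open>A i y m\<close> with columns \<open>y\<close> increase with the
  level \<open>m\<close>. At level \<open>m\<close> a cell may use at most \<open>m\<close> columns of a row, since in a linked matrix the
  intersection of \<open>m + 1\<close> of them is finite.
\<close>

definition cells :: "('r \<Rightarrow> 'c \<Rightarrow> nat \<Rightarrow> 'a set) \<Rightarrow> 'r set \<Rightarrow> 'a set set" where
  "cells A R = {{n. \<forall>i\<in>r. \<forall>y\<in>\<sigma> i. n \<in> A i y (m i)} | r \<sigma> m.
     finite r \<and> r \<subseteq> R \<and> (\<forall>i\<in>r. finite (\<sigma> i) \<and> card (\<sigma> i) \<le> m i)}"

lemma cellsE:
  assumes "Z \<in> cells A R"
  obtains r \<sigma> m where "finite r" "r \<subseteq> R" "\<And>i. i \<in> r \<Longrightarrow> finite (\<sigma> i)"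
    "\<And>i. i \<in> r \<Longrightarrow> card (\<sigma> i) \<le> m i" "Z = {n. \<forall>i\<in>r. \<forall>y\<in>\<sigma> i. n \<in> A i y (m i)}"
  using assms unfolding cells_def by blast

lemma cellsI:
  assumes "finite r" "r \<subseteq> R" "\<And>i. i \<in> r \<Longrightarrow> finite (\<sigma> i)" "\<And>i. i \<in> r \<Longrightarrow> card (\<sigma> i) \<le> m i"
    and "Z = {n. \<forall>i\<in>r. \<forall>y\<in>\<sigma> i. n \<in> A i y (m i)}"
  shows "Z \<in> cells A R"
  using assms unfolding cells_def by blast

lemma UNIV_in_cells: "UNIV \<in> cells A R"
  by (rule cellsI[of "{}"]) auto

lemma cells_mono: "R \<subseteq> S \<Longrightarrow> cells A R \<subseteq> cells A S"
  unfolding cells_def by blast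

lemma cells_finite_support:
  assumes "Z \<in> cells A R"
  obtains r where "finite r" "r \<subseteq> R" "Z \<in> cells A r"
proof -
  obtain r \<sigma> m where r: "finite r" "r \<subseteq> R" "\<And>i. i \<in> r \<Longrightarrow> finite (\<sigma> i)"
    "\<And>i. i \<in> r \<Longrightarrow> card (\<sigma> i) \<le> m i" "Z = {n. \<forall>i\<in>r. \<forall>y\<in>\<sigma> i. n \<in> A i y (m i)}"
    using assms by (rule cellsE) blast
  have "Z \<in> cells A r"
    by (rule cellsI[of r r \<sigma> m Z A]) (use r in auto)
  with r that show ?thesis by blast
qed

lemma single_row_in_cells: "finite Y \<Longrightarrow> {n. \<forall>y\<in>Y. n \<in> A i y (card Y)} \<in> cells A {i}"
  by (rule cellsI[of "{i}" _ "\<lambda>_. Y" "\<lambda>_. card Y"]) auto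

lemma cells_Int:
  assumes "Y \<in> cells A R" "Z \<in> cells A S" "R \<inter> S = {}"
  shows "Y \<inter> Z \<in> cells A (R \<union> S)"
proof -
  obtain r \<sigma> m where r: "finite r" "r \<subseteq> R" "\<And>i. i \<in> r \<Longrightarrow> finite (\<sigma> i)"
    "\<And>i. i \<in> r \<Longrightarrow> card (\<sigma> i) \<le> m i" "Y = {n. \<forall>i\<in>r. \<forall>y\<in>\<sigma> i. n \<in> A i y (m i)}"
    using assms(1) by (rule cellsE) blast
  obtain s \<tau> l where s: "finite s" "s \<subseteq> S" "\<And>i. i \<in> s \<Longrightarrow> finite (\<tau> i)"
    "\<And>i. i \<in> s \<Longrightarrow> card (\<tau> i) \<le> l i" "Z = {n. \<forall>i\<in>s. \<forall>y\<in>\<tau> i. n \<in> A i y (l i)}"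
    using assms(2) by (rule cellsE) blast
  have disj: "i \<notin> r" if "i \<in> s" for i
    using that r(2) s(2) assms(3) by blast
  show ?thesis
  proof (rule cellsI[of "r \<union> s" _ "\<lambda>i. if i \<in> r then \<sigma> i else \<tau> i" "\<lambda>i. if i \<in> r then m i else l i"])
    show "Y \<inter> Z = {n. \<forall>i\<in>r \<union> s. \<forall>y\<in>(if i \<in> r then \<sigma> i else \<tau> i).
        n \<in> A i y (if i \<in> r then m i else l i)}"
      unfolding r(5) s(5) using disj by auto
  qed (use r s in auto)
qed

definition prefix_code :: "nat set \<Rightarrow> nat \<Rightarrow> nat" where
  "prefix_code y k = set_encode (y \<inter> {..<k})"

lemma prefix_code_less: "prefix_code y k < 2 ^ k"
proof -
  have "prefix_code y k \<le> (\<Sum>j<k. 2 ^ j)"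
    unfolding prefix_code_def set_encode_def by (rule sum_mono2) auto
  also have "\<dots> < 2 ^ k"
    by (induction k) auto
  finally show ?thesis .
qed

lemma eventually_inj_on_prefix_code:
  assumes "finite Y"
  shows "\<forall>\<^sub>F k in sequentially. inj_on (\<lambda>y. prefix_code y k) Y"
proof -
  have "\<forall>\<^sub>F k in sequentially. prefix_code y k = prefix_code z k \<longrightarrow> y = z" for y z
  proof (cases "y = z")
    case False
    then obtain j where j: "(j \<in> y) \<noteq> (j \<in> z)"
      by blast
    show ?thesis
      using eventually_gt_at_top[of j]
    proof eventually_elim
      case (elim k)
      then have "y \<inter> {..<k} \<noteq> z \<inter> {..<k}"
        using j by auto
      then show ?case
        by (simp add: prefix_code_def set_encode_eq)
    qed
  qed simp
  then have "\<forall>\<^sub>F k in sequentially. \<forall>y\<in>Y. \<forall>z\<in>Y. prefix_code y k = prefix_code z k \<longrightarrow> y = z"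
    by (intro eventually_ball_finite assms ballI)
  then show ?thesis
    by (simp add: inj_on_def)
qed

text \<open>
  The block from \<open>s k\<close> to \<open>s (Suc k)\<close> takes each of finitely many prescribed values \<open>u\<close> so often that
  the earlier points, \<open>s k\<close> in number, are negligible against the points with value \<open>u\<close>, even when
  counted \<open>2 * k\<close> times.
\<close>

lemma rapidly_growing_blocks:
  fixes d :: "nat \<Rightarrow> 'a"
  assumes "\<And>k. finite (U k)" and "\<And>k u. u \<in> U k \<Longrightarrow> infinite {n. d n = u}"
  obtains s :: "nat \<Rightarrow> nat"
  where "s 0 = 0" "strict_mono s"
    "\<And>k u. u \<in> U k \<Longrightarrow> 2 * k * s k < card {n \<in> {s k..<s (Suc k)}. d n = u}"
proof -
  have "\<exists>y. x < y \<and> (\<forall>u\<in>U k. 2 * k * x < card {n \<in> {x..<y}. d n = u})" for x k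
  proof -
    have "\<forall>\<^sub>F y in sequentially. 2 * k * x < card {n \<in> {x..<y}. d n = u}" if "u \<in> U k" for u
    proof -
      have "infinite ({n. d n = u} - {..<x})"
        using assms(2)[OF that] by auto
      then obtain T where T: "finite T" "card T = Suc (2 * k * x)" "T \<subseteq> {n. d n = u} - {..<x}"
        using infinite_arbitrarily_large by metis
      show ?thesis
        using eventually_gt_at_top[of "Max (insert 0 T)"]
      proof eventually_elim
        case (elim y)
        then have "T \<subseteq> {n \<in> {x..<y}. d n = u}"
          using T Max_ge[of "insert 0 T"] by force
        then have "card T \<le> card {n \<in> {x..<y}. d n = u}"
          by (intro card_mono) auto
        then show ?case
          using T by simp
      qed
    qed
    then have "\<forall>\<^sub>F y in sequentially. \<forall>u\<in>U k. 2 * k * x < card {n \<in> {x..<y}. d n = u}"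
      by (intro eventually_ball_finite assms(1) ballI)
    then have "\<forall>\<^sub>F y in sequentially. x < y \<and> (\<forall>u\<in>U k. 2 * k * x < card {n \<in> {x..<y}. d n = u})"
      using eventually_gt_at_top[of x] by (rule eventually_conj[rotated])
    then show ?thesis
      by (rule eventually_happens'[OF sequentially_bot])
  qed
  then have "\<forall>k x. \<exists>y. x < y \<and> (\<forall>u\<in>U k. 2 * k * x < card {n \<in> {x..<y}. d n = u})"
    by blast
  then obtain g where g: "\<And>k x. x < g k x"
    "\<And>k x u. u \<in> U k \<Longrightarrow> 2 * k * x < card {n \<in> {x..<g k x}. d n = u}"
    unfolding choice_iff by blast
  define s where "s = rec_nat 0 g"
  have s: "s 0 = 0" "s (Suc k) = g k (s k)" for k
    by (simp_all add: s_def)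
  show ?thesis
    by (rule that[of s]) (use g in \<open>auto simp: s strict_mono_Suc_iff simp del: atLeastLessThan_iff\<close>)
qed

text \<open>
  Kunen's matrix, with continuum many rows and columns. A point \<open>n\<close> of the \<open>k\<close>-th block codes a
  function \<open>d n\<close> that assigns to each possible trace on \<open>{..<k}\<close> of a row a list of possible traces
  of columns, all traces being coded as numbers; it belongs to \<open>A i y m\<close> iff the trace of \<open>y\<close> is among
  the first \<open>m\<close> entries of the list assigned to the trace of \<open>i\<close>. So \<open>m + 1\<close> columns with different
  traces have no common point in that block; this makes the matrix linked. For large \<open>k\<close> different
  rows have different traces, so the lists can be prescribed separately for each row; this makes every
  cell meet the block, and in many points because each function is coded many times.
\<close>

lemma linked_matrix_exists:
  obtains \<pi> :: "nat \<Rightarrow> nat" and A :: "nat set \<Rightarrow> nat set \<Rightarrow> nat \<Rightarrow> nat set"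
  where "\<And>k. finite {n. \<pi> n < k}"
    and "\<And>i y m. A i y m \<subseteq> A i y (Suc m)"
    and "\<And>i Y m. card Y = Suc m \<Longrightarrow> finite {n. \<forall>y\<in>Y. n \<in> A i y m}"
    and "\<And>Z. Z \<in> cells A UNIV \<Longrightarrow>
           \<forall>\<^sub>F k in sequentially. 2 * k * card {n. \<pi> n < k} < card {n \<in> Z. \<pi> n = k}"
proof -
  define d :: "nat \<Rightarrow> nat list list" where "d n = from_nat (fst (prod_decode n))" for n
  define U :: "nat \<Rightarrow> nat list list set" where
    "U k = {u. set u \<subseteq> {l. set l \<subseteq> {..<2 ^ k} \<and> length l \<le> k} \<and> length u = 2 ^ k}" for k
  have inf_d: "infinite {n. d n = u}" for u
  proof -
    have "range (\<lambda>j. prod_encode (to_nat u, j)) \<subseteq> {n. d n = u}"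
      by (auto simp: d_def)
    moreover have "inj (\<lambda>j. prod_encode (to_nat u, j))"
      by (auto simp: inj_def)
    ultimately show ?thesis
      by (meson infinite_super range_inj_infinite)
  qed
  have fin_U: "finite (U k)" for k
    unfolding U_def by (intro finite_lists_length_eq finite_lists_length_le) simp
  obtain s :: "nat \<Rightarrow> nat" where s0: "s 0 = 0" and s_mono: "strict_mono s"
    and s_card: "\<And>k u. u \<in> U k \<Longrightarrow> 2 * k * s k < card {n \<in> {s k..<s (Suc k)}. d n = u}"
    by (rule rapidly_growing_blocks[of U d, OF fin_U inf_d]) (rule that)
  define \<pi> where "\<pi> n = (LEAST k. n < s (Suc k))" for n
  have ex: "\<exists>k. n < s (Suc k)" for n
    using strict_mono_imp_increasing[OF s_mono, of "Suc n"] by (intro exI[of _ n]) simp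
  have \<pi>_less: "\<pi> n < k \<longleftrightarrow> n < s k" for n k
  proof (cases k)
    case 0
    then show ?thesis by (simp add: s0)
  next
    case (Suc j)
    have "\<pi> n \<le> j \<longleftrightarrow> n < s (Suc j)"
    proof
      assume "\<pi> n \<le> j"
      then have "s (Suc (\<pi> n)) \<le> s (Suc j)"
        using s_mono by (simp add: strict_mono_less_eq)
      moreover have "n < s (Suc (\<pi> n))"
        unfolding \<pi>_def using ex by (rule LeastI_ex)
      ultimately show "n < s (Suc j)" by simp
    qed (auto simp: \<pi>_def intro: Least_le)
    then show ?thesis using Suc by (simp add: less_Suc_eq_le)
  qed
  have \<pi>_eq: "\<pi> n = k \<longleftrightarrow> n \<in> {s k..<s (Suc k)}" for n k
    using \<pi>_less[of n k] \<pi>_less[of n "Suc k"] by auto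
  have \<pi>_set: "{n. \<pi> n < k} = {..<s k}" for k
    by (auto simp: \<pi>_less)
  define A :: "nat set \<Rightarrow> nat set \<Rightarrow> nat \<Rightarrow> nat set" where
    "A i y m = {n. prefix_code y (\<pi> n) \<in> set (take m (d n ! prefix_code i (\<pi> n)))}" for i y m
  show ?thesis
  proof (rule that[of \<pi> A])
    show "finite {n. \<pi> n < k}" for k
      by (simp add: \<pi>_set)
    show "A i y m \<subseteq> A i y (Suc m)" for i y m
      using set_take_subset_set_take[of m "Suc m"] by (force simp: A_def)
  next
    fix i Y and m :: nat
    assume card: "card (Y :: nat set set) = Suc m"
    then have "finite Y"
      by (metis card.infinite nat.distinct(1))
    then obtain k0 where k0: "\<And>k. k \<ge> k0 \<Longrightarrow> inj_on (\<lambda>y. prefix_code y k) Y"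
      using eventually_inj_on_prefix_code by (metis eventually_sequentially)
    have "\<pi> n < k0" if n: "\<forall>y\<in>Y. n \<in> A i y m" for n
    proof (rule ccontr)
      assume "\<not> \<pi> n < k0"
      then have "card ((\<lambda>y. prefix_code y (\<pi> n)) ` Y) = Suc m"
        using k0 card by (simp add: card_image)
      moreover have "(\<lambda>y. prefix_code y (\<pi> n)) ` Y \<subseteq> set (take m (d n ! prefix_code i (\<pi> n)))"
        using n by (auto simp: A_def)
      ultimately have "Suc m \<le> card (set (take m (d n ! prefix_code i (\<pi> n))))"
        by (metis List.finite_set card_mono)
      also have "\<dots> \<le> length (take m (d n ! prefix_code i (\<pi> n)))"
        by (rule card_length)
      finally show False by simp
    qed
    then show "finite {n. \<forall>y\<in>Y. n \<in> A i y m}"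
      by (rule_tac finite_subset[of _ "{..<s k0}"]) (auto simp: \<pi>_less)
  next
    fix Z assume "Z \<in> cells A UNIV"
    then obtain r \<sigma> m where r: "finite r" "\<And>i. i \<in> r \<Longrightarrow> finite (\<sigma> i)"
      "\<And>i. i \<in> r \<Longrightarrow> card (\<sigma> i) \<le> m i" and Z: "Z = {n. \<forall>i\<in>r. \<forall>y\<in>\<sigma> i. n \<in> A i y (m i)}"
      by (rule cellsE) blast
    have "\<forall>\<^sub>F k in sequentially. \<forall>i\<in>r. m i \<le> k"
      using r(1) by (intro eventually_ball_finite ballI eventually_ge_at_top)
    with eventually_inj_on_prefix_code[OF r(1)]
    show "\<forall>\<^sub>F k in sequentially. 2 * k * card {n. \<pi> n < k} < card {n \<in> Z. \<pi> n = k}"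
    proof eventually_elim
      case (elim k)
      \<comment> \<open>The function \<open>u\<close> lists, at the trace of each row \<open>i\<close> of the cell, the traces of its columns.\<close>
      define l where "l i = sorted_list_of_set ((\<lambda>y. prefix_code y k) ` \<sigma> i)" for i
      define u where "u = map (\<lambda>x. if x \<in> (\<lambda>i. prefix_code i k) ` r
        then l (the_inv_into r (\<lambda>i. prefix_code i k) x) else []) [0..<2 ^ k]"
      have l: "length (l i) \<le> m i" "set (l i) = (\<lambda>y. prefix_code y k) ` \<sigma> i" if "i \<in> r" for i
        using r(2,3)[OF that] card_image_le[OF r(2)[OF that], of "\<lambda>y. prefix_code y k"]
        by (auto simp: l_def)
      have u_nth: "u ! prefix_code i k = l i" if "i \<in> r" for i
        using that the_inv_into_f_f[OF elim(1) that] by (simp add: u_def prefix_code_less)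
      have "u \<in> U k"
        using l le_trans[OF l(1)] elim(2) prefix_code_less
        by (auto simp: U_def u_def the_inv_into_f_f[OF elim(1)])
      have "{n \<in> {s k..<s (Suc k)}. d n = u} \<subseteq> {n \<in> Z. \<pi> n = k}"
      proof safe
        fix n assume n: "n \<in> {s k..<s (Suc k)}" "u = d n"
        then show k: "\<pi> n = k" by (simp add: \<pi>_eq)
        show "n \<in> Z"
          using l u_nth k n(2) by (auto simp: Z A_def)
      qed
      then have "card {n \<in> {s k..<s (Suc k)}. d n = u} \<le> card {n \<in> Z. \<pi> n = k}"
        by (intro card_mono finite_subset[of "{n \<in> Z. \<pi> n = k}" "{s k..<s (Suc k)}"])
           (auto simp: \<pi>_eq)
      then show ?case
        using s_card[OF \<open>u \<in> U k\<close>] by (simp add: \<pi>_set)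
    qed
  qed
qed

section \<open>Filters that leave rows of the matrix independent\<close>

text \<open>
  The set \<open>Q\<close> is instantiated to the sets \<open>\<pi> -` a b\<close> for nonempty clopen \<open>b\<close>, and \<open>R\<close> is the set of
  rows that are still unused.
\<close>

definition cell_independent ::
    "('r \<Rightarrow> 'c \<Rightarrow> nat \<Rightarrow> 'a set) \<Rightarrow> 'a set set \<Rightarrow> 'a filter \<Rightarrow> 'r set \<Rightarrow> bool" where
  "cell_independent A Q F R \<longleftrightarrow> (\<forall>P\<in>Q. \<forall>Z\<in>cells A R. \<exists>\<^sub>F n in F. n \<in> P \<and> n \<in> Z)"

text \<open>
  What remains of Boolean algebra in \<open>Q\<close>: below any member \<open>P'\<close> there is a member that, modulo the
  filter, lies inside \<open>P\<close> or is disjoint from \<open>P\<close>.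
\<close>

definition splitting :: "'a set set \<Rightarrow> 'a filter \<Rightarrow> bool" where
  "splitting Q F \<longleftrightarrow> (\<forall>P\<in>Q. \<forall>P'\<in>Q. \<exists>P''\<in>Q.
     (\<forall>\<^sub>F n in F. n \<in> P'' \<longrightarrow> n \<in> P' \<and> n \<in> P) \<or> (\<forall>\<^sub>F n in F. n \<in> P'' \<longrightarrow> n \<in> P' \<and> n \<notin> P))"

text \<open>
  Either some \<open>C k\<close> is null on a member of \<open>Q\<close>, and so cannot belong to any extension of the filter for
  which all of \<open>Q\<close> is positive, or all \<open>C k\<close> belong to the filter together with Kunen's sets \<open>V y\<close>.
  Extensions of the filter inherit both alternatives, so each sequence has to be treated only once.
\<close>

definition settled :: "'c itself \<Rightarrow> 'a set set \<Rightarrow> (nat \<Rightarrow> 'a set) \<Rightarrow> 'a filter \<Rightarrow> bool" where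
  "settled _ Q C F \<longleftrightarrow>
     (\<exists>k. \<exists>P\<in>Q. \<forall>\<^sub>F n in F. \<not> (n \<in> P \<and> n \<in> C k)) \<or>
     (\<exists>V :: 'c \<Rightarrow> 'a set. (\<forall>y. \<forall>\<^sub>F n in F. n \<in> V y) \<and>
        (\<forall>Y k. card Y = Suc k \<longrightarrow> finite {n. (\<forall>y\<in>Y. n \<in> V y) \<and> n \<notin> C k})) \<and>
     (\<forall>k. \<forall>\<^sub>F n in F. n \<in> C k)"

lemma cell_independentD:
  "cell_independent A Q F R \<Longrightarrow> P \<in> Q \<Longrightarrow> Z \<in> cells A R \<Longrightarrow> \<exists>\<^sub>F n in F. n \<in> P \<and> n \<in> Z"
  by (simp add: cell_independent_def)

lemma splitting_mono: "splitting Q F \<Longrightarrow> G \<le> F \<Longrightarrow> splitting Q G"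
  unfolding splitting_def le_filter_def by meson

lemma settled_mono:
  fixes F G :: "'a filter"
  assumes "settled TYPE('c) Q C F" "G \<le> F"
  shows "settled TYPE('c) Q C G"
proof -
  have ev: "\<forall>\<^sub>F n in F. p n \<Longrightarrow> \<forall>\<^sub>F n in G. p n" for p
    using assms(2) by (simp add: le_filter_def)
  from assms(1)[unfolded settled_def] show ?thesis
  proof (elim disjE)
    assume "\<exists>k. \<exists>P\<in>Q. \<forall>\<^sub>F n in F. \<not> (n \<in> P \<and> n \<in> C k)"
    then show ?thesis
      unfolding settled_def using ev by (intro disjI1) blast
  next
    assume "(\<exists>V :: 'c \<Rightarrow> 'a set. (\<forall>y. \<forall>\<^sub>F n in F. n \<in> V y) \<and>
        (\<forall>Y k. card Y = Suc k \<longrightarrow> finite {n. (\<forall>y\<in>Y. n \<in> V y) \<and> n \<notin> C k})) \<and> (\<forall>k. \<forall>\<^sub>F n in F. n \<in> C k)"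
    then show ?thesis
      unfolding settled_def using ev by (intro disjI2) blast
  qed
qed

lemma frequently_inf_principal:
  "(\<exists>\<^sub>F n in inf F (principal S). P n) \<longleftrightarrow> (\<exists>\<^sub>F n in F. n \<in> S \<and> P n)"
  by (simp add: frequently_def eventually_inf_principal)

lemma eventually_inf_INF_principal:
  assumes "eventually P (inf F (INF i\<in>I. principal (V i)))"
  obtains J where "finite J" "J \<subseteq> I" "\<forall>\<^sub>F n in F. (\<forall>i\<in>J. n \<in> V i) \<longrightarrow> P n"
proof -
  obtain Q R where QR: "eventually Q F" "eventually R (INF i\<in>I. principal (V i))"
    "\<forall>x. Q x \<and> R x \<longrightarrow> P x"
    using assms unfolding eventually_inf by blast
  then obtain J where J: "finite J" "J \<subseteq> I" "eventually R (INF i\<in>J. principal (V i))"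
    unfolding eventually_INF[of _ _ I] by blast
  then have "eventually R (principal (\<Inter>i\<in>J. V i))"
    by (simp add: INF_principal_finite)
  then have "\<forall>n. (\<forall>i\<in>J. n \<in> V i) \<longrightarrow> R n"
    by (auto simp: eventually_principal)
  with QR have "\<forall>\<^sub>F n in F. (\<forall>i\<in>J. n \<in> V i) \<longrightarrow> P n"
    by (auto elim: eventually_mono)
  with J that show ?thesis by blast
qed

text \<open>
  The new member \<open>- P \<union> Z\<close> forces \<open>P\<close> into \<open>Z\<close>. It costs only the rows of \<open>Z\<close>: a member of \<open>Q\<close>
  inside \<open>P\<close> meets \<open>Z\<close> and any cell on other rows, because the intersection of the two is again a
  cell, and a member outside \<open>P\<close> is not affected.
\<close>

lemma independent_refute:
  assumes ind: "cell_independent A Q F R" and spl: "splitting Q F"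
    and P: "P \<in> Q" and Z: "Z \<in> cells A r" and r: "r \<subseteq> R"
  shows "cell_independent A Q (inf F (principal (- P \<union> Z))) (R - r)"
  unfolding cell_independent_def frequently_inf_principal
proof (intro ballI)
  fix P' Z' assume P': "P' \<in> Q" and Z': "Z' \<in> cells A (R - r)"
  obtain P'' where P'': "P'' \<in> Q"
    "(\<forall>\<^sub>F n in F. n \<in> P'' \<longrightarrow> n \<in> P' \<and> n \<in> P) \<or> (\<forall>\<^sub>F n in F. n \<in> P'' \<longrightarrow> n \<in> P' \<and> n \<notin> P)"
    using spl P P' unfolding splitting_def by blast
  have "Z \<inter> Z' \<in> cells A (r \<union> (R - r))"
    using Z Z' by (intro cells_Int) auto
  then have "\<exists>\<^sub>F n in F. n \<in> P'' \<and> n \<in> Z \<inter> Z'"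
    using ind P''(1) r by (intro cell_independentD) (auto simp: Un_absorb1)
  with P''(2) show "\<exists>\<^sub>F n in F. n \<in> - P \<union> Z \<and> n \<in> P' \<and> n \<in> Z'"
    by (elim disjE) (auto elim!: frequently_rev_mp eventually_mono)
qed

text \<open>
  Kunen's step. Row \<open>i\<close> is spent at increasing levels along the sequence: on the difference of
  \<open>C m\<close> and \<open>C (m + 1)\<close> the set \<open>V y\<close> is \<open>A i y m\<close>. Outside \<open>C k\<close> only levels below \<open>k\<close> occur, where
  \<open>k + 1\<close> columns have finite intersection; and \<open>m\<close> of the sets contain, inside \<open>C m\<close>, the
  intersection of their columns at level \<open>m\<close>, which is a cell.
\<close>

lemma independent_linked_sets:
  fixes A :: "'r \<Rightarrow> 'c \<Rightarrow> nat \<Rightarrow> 'a set"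
  assumes mono: "\<And>i y m. A i y m \<subseteq> A i y (Suc m)"
    and linked: "\<And>Y m. card Y = Suc m \<Longrightarrow> finite {n. \<forall>y\<in>Y. n \<in> A i y m}"
    and ind: "cell_independent A Q F R" and i: "i \<in> R"
    and C: "decseq C" "\<And>k. \<forall>\<^sub>F n in F. n \<in> C k"
  obtains V :: "'c \<Rightarrow> 'a set"
  where "cell_independent A Q (inf F (INF y. principal (V y))) (R - {i})"
    and "\<And>Y k. card Y = Suc k \<Longrightarrow> finite {n. (\<forall>y\<in>Y. n \<in> V y) \<and> n \<notin> C k}"
proof -
  have A_mono: "A i y m \<subseteq> A i y m'" if "m \<le> m'" for y m m'
    using mono that by (rule lift_Suc_mono_le)
  define V where "V y = {n \<in> C 0. \<forall>m. n \<in> C m \<and> n \<notin> C (Suc m) \<longrightarrow> n \<in> A i y m}" for y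
  have V_in: "n \<in> V y" if "n \<in> A i y m" "n \<in> C m" for n y m
  proof -
    have "m \<le> m'" if "n \<notin> C (Suc m')" for m'
      using \<open>n \<in> C m\<close> that decseqD[OF C(1), of "Suc m'" m] by (meson not_less_eq_eq subsetD)
    moreover have "n \<in> C 0"
      using \<open>n \<in> C m\<close> decseqD[OF C(1), of 0 m] by auto
    ultimately show ?thesis
      using that(1) A_mono unfolding V_def by blast
  qed
  have V_out: "n \<in> A i y k" if "n \<in> V y" "n \<notin> C k" for n y k
  proof -
    have "\<exists>m<k. n \<in> C m \<and> n \<notin> C (Suc m)"
      using that unfolding V_def by (induction k) (auto, metis less_Suc_eq)
    then obtain m where m: "m < k" "n \<in> C m" "n \<notin> C (Suc m)"
      by blast
    then have "n \<in> A i y m"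
      using that(1) by (simp add: V_def)
    with A_mono[of m k y] m(1) show ?thesis
      by auto
  qed
  show ?thesis
  proof
    show "cell_independent A Q (inf F (INF y. principal (V y))) (R - {i})"
      unfolding cell_independent_def
    proof (intro ballI)
      fix P Z assume P: "P \<in> Q" and Z: "Z \<in> cells A (R - {i})"
      show "\<exists>\<^sub>F n in inf F (INF y. principal (V y)). n \<in> P \<and> n \<in> Z"
        unfolding frequently_def
      proof
        assume "\<forall>\<^sub>F n in inf F (INF y. principal (V y)). \<not> (n \<in> P \<and> n \<in> Z)"
        then obtain Y where Y: "finite Y"
          "\<forall>\<^sub>F n in F. (\<forall>y\<in>Y. n \<in> V y) \<longrightarrow> \<not> (n \<in> P \<and> n \<in> Z)"
          by (rule eventually_inf_INF_principal)
        have "Z \<inter> {n. \<forall>y\<in>Y. n \<in> A i y (card Y)} \<in> cells A ((R - {i}) \<union> {i})"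
          using Z Y(1) by (intro cells_Int single_row_in_cells) auto
        then have "\<exists>\<^sub>F n in F. n \<in> P \<and> n \<in> Z \<inter> {n. \<forall>y\<in>Y. n \<in> A i y (card Y)}"
          using ind P i by (intro cell_independentD) (auto simp: insert_absorb)
        moreover have "\<forall>\<^sub>F n in F. \<not> (n \<in> P \<and> n \<in> Z \<inter> {n. \<forall>y\<in>Y. n \<in> A i y (card Y)})"
          using Y(2) C(2)[of "card Y"] by eventually_elim (use V_in in blast)
        ultimately show False
          by (simp add: frequently_def)
      qed
    qed
  next
    fix Y :: "'c set" and k assume "card Y = Suc k"
    from linked[OF this] show "finite {n. (\<forall>y\<in>Y. n \<in> V y) \<and> n \<notin> C k}"
      by (rule rev_finite_subset) (use V_out in auto)
  qed
qed

text \<open>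
  If the members of \<open>C\<close> can be added, Kunen's step applies to the enlarged filter. Otherwise a single
  \<open>C k\<close> is null on \<open>P \<inter> Z\<close> for some \<open>P\<close> in \<open>Q\<close> and some cell \<open>Z\<close>, and forcing \<open>P\<close> into \<open>Z\<close> makes it
  null on \<open>P\<close>.
\<close>

lemma independent_settle:
  fixes A :: "'r \<Rightarrow> 'c \<Rightarrow> nat \<Rightarrow> 'a set"
  assumes mono: "\<And>i y m. A i y m \<subseteq> A i y (Suc m)"
    and linked: "\<And>i Y m. card Y = Suc m \<Longrightarrow> finite {n. \<forall>y\<in>Y. n \<in> A i y m}"
    and ind: "cell_independent A Q F R" and spl: "splitting Q F"
    and R: "R \<noteq> {}" and C: "decseq C"
  shows "\<exists>G W. finite W \<and> cell_independent A Q (inf F G) (R - W) \<and> settled TYPE('c) Q C (inf F G)"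
proof (cases "cell_independent A Q (inf F (INF k. principal (C k))) R")
  case True
  let ?H = "inf F (INF k. principal (C k))"
  obtain i where i: "i \<in> R" using R by blast
  have "\<forall>\<^sub>F n in (INF k. principal (C k)). n \<in> C k" for k
    by (rule eventually_INF1[of k]) (auto simp: eventually_principal)
  then have H: "\<forall>\<^sub>F n in ?H. n \<in> C k" for k
    by (rule filter_leD[OF inf_le2])
  obtain V :: "'c \<Rightarrow> 'a set" where V:
    "cell_independent A Q (inf ?H (INF y. principal (V y))) (R - {i})"
    "\<And>Y k. card Y = Suc k \<Longrightarrow> finite {n. (\<forall>y\<in>Y. n \<in> V y) \<and> n \<notin> C k}"
    by (rule independent_linked_sets[OF mono linked True i C H]) (assumption, rule that)
  have "\<forall>\<^sub>F n in (INF y. principal (V y)). n \<in> V y" for y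
    by (rule eventually_INF1[of y]) (auto simp: eventually_principal)
  then have "\<forall>\<^sub>F n in inf ?H (INF y. principal (V y)). n \<in> V y" for y
    by (rule filter_leD[OF inf_le2])
  moreover have "\<forall>\<^sub>F n in inf ?H (INF y. principal (V y)). n \<in> C k" for k
    using H by (rule filter_leD[OF inf_le1])
  ultimately have "settled TYPE('c) Q C (inf ?H (INF y. principal (V y)))"
    unfolding settled_def using V(2) by blast
  with V(1) show ?thesis
    by (intro exI[of _ "inf (INF k. principal (C k)) (INF y. principal (V y))"] exI[of _ "{i}"])
       (simp add: inf_assoc)
next
  case False
  then obtain P Z where P: "P \<in> Q" and Z: "Z \<in> cells A R"
    and ev: "\<forall>\<^sub>F n in inf F (INF k. principal (C k)). \<not> (n \<in> P \<and> n \<in> Z)"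
    unfolding cell_independent_def frequently_def by auto
  obtain J where J: "finite J" "\<forall>\<^sub>F n in F. (\<forall>k\<in>J. n \<in> C k) \<longrightarrow> \<not> (n \<in> P \<and> n \<in> Z)"
    using ev by (rule eventually_inf_INF_principal)
  define k where "k = Max (insert 0 J)"
  have "C k \<subseteq> C j" if "j \<in> J" for j
    using J(1) that C by (intro decseqD[of C]) (auto simp: k_def)
  then have *: "\<forall>\<^sub>F n in F. n \<in> C k \<longrightarrow> \<not> (n \<in> P \<and> n \<in> Z)"
    using J(2) by (auto elim!: eventually_mono)
  obtain r where r: "finite r" "r \<subseteq> R" "Z \<in> cells A r"
    using Z by (rule cells_finite_support)
  have "\<forall>\<^sub>F n in inf F (principal (- P \<union> Z)). \<not> (n \<in> P \<and> n \<in> C k)"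
    unfolding eventually_inf_principal using * by eventually_elim auto
  then have "settled TYPE('c) Q C (inf F (principal (- P \<union> Z)))"
    unfolding settled_def using P by blast
  with r independent_refute[OF ind spl P r(3,2)] show ?thesis by blast
qed

unbundle cardinal_syntax

text \<open>
  A well-order of minimal type: fewer stages precede any given stage than there are rows, so that
  an unused row is always left.
\<close>

lemma cardinal_wellorder_exists:
  obtains L :: "('r \<times> 'r) set"
  where "wf L" "trans L" "\<And>s t. s \<noteq> t \<Longrightarrow> (s, t) \<in> L \<or> (t, s) \<in> L"
    "\<And>t. |{s. (s, t) \<in> L}| <o |UNIV :: 'r set|"
proof -
  let ?r = "|UNIV :: 'r set|"
  have card: "Card_order ?r" and wo: "well_order_on UNIV ?r" and Field: "Field ?r = UNIV"
    using card_of_Card_order[of "UNIV :: 'r set"] card_of_card_order_on[of "UNIV :: 'r set"]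
    by (auto simp: card_order_on_def Field_card_of)
  then have lin: "linear_order_on UNIV ?r" and wf: "wf (?r - Id)"
    by (auto simp: well_order_on_def)
  show ?thesis
  proof (rule that[of "?r - Id"])
    show "wf (?r - Id)" by (rule wf)
    show "trans (?r - Id)"
      using lin by (intro trans_diff_Id) (auto simp: order_on_defs)
    show "(s, t) \<in> ?r - Id \<or> (t, s) \<in> ?r - Id" if "s \<noteq> t" for s t
      using lin that by (auto simp: order_on_defs total_on_def)
    show "|{s. (s, t) \<in> ?r - Id}| <o ?r" for t
      using card_of_underS[OF card, of t] Field
      by (auto simp: underS_def conj_commute)
  qed
qed

lemma UN_finite_sets_neq_UNIV:
  fixes W :: "'r \<Rightarrow> 'r set"
  assumes inf: "infinite (UNIV :: 'r set)" and S: "|S| <o |UNIV :: 'r set|"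
    and W: "\<And>s. s \<in> S \<Longrightarrow> finite (W s)"
  shows "(\<Union>s\<in>S. W s) \<noteq> UNIV"
proof (cases "finite S")
  case True
  then have "finite (\<Union>s\<in>S. W s)"
    using W by blast
  with inf show ?thesis by metis
next
  case False
  have "|W s| \<le>o |S|" if "s \<in> S" for s
    using W[OF that] False
    by (intro ordLess_imp_ordLeq finite_ordLess_infinite card_of_Well_order) (simp_all add: Field_card_of)
  then have "|\<Union>s\<in>S. W s| \<le>o |S|"
    using False by (intro card_of_UNION_ordLeq_infinite) (auto simp: card_of_refl ordIso_imp_ordLeq)
  then have "|\<Union>s\<in>S. W s| <o |UNIV :: 'r set|"
    using S by (rule ordLeq_ordLess_trans)
  then show ?thesis
    using ordLess_irreflexive by metis
qed

lemma finite_has_last: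
  assumes "trans L" and total: "\<And>s t. s \<noteq> t \<Longrightarrow> (s, t) \<in> L \<or> (t, s) \<in> L"
    and "finite J" "J \<noteq> {}"
  shows "\<exists>t\<in>J. \<forall>s\<in>J. s = t \<or> (s, t) \<in> L"
  using assms(3,4)
proof (induction rule: finite_ne_induct)
  case (insert x J)
  then obtain t where t: "t \<in> J" "\<forall>s\<in>J. s = t \<or> (s, t) \<in> L"
    by blast
  show ?case
  proof (cases "(t, x) \<in> L")
    case True
    then have "\<forall>s\<in>insert x J. s = x \<or> (s, x) \<in> L"
      using t(2) transD[OF \<open>trans L\<close>, of _ t x] by auto
    then show ?thesis by blast
  next
    case False
    then have "x = t \<or> (x, t) \<in> L"
      using total by blast
    then show ?thesis using t by blast
  qed
qed simp

text \<open>
  Sequences are indexed by rows, so a well-order of minimal type on the rows schedules them. Before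
  each stage fewer rows than there are in total have been spent, finitely many at each earlier stage.
  Independence survives limits because an event of an infimum of filters involves finitely many of
  them, hence a single earlier stage.
\<close>

lemma settling_filter_exists:
  fixes A :: "'r \<Rightarrow> 'c \<Rightarrow> nat \<Rightarrow> 'a set" and C :: "'r \<Rightarrow> nat \<Rightarrow> 'a set"
  assumes mono: "\<And>i y m. A i y m \<subseteq> A i y (Suc m)"
    and linked: "\<And>i Y m. card Y = Suc m \<Longrightarrow> finite {n. \<forall>y\<in>Y. n \<in> A i y m}"
    and ind: "cell_independent A Q F\<^sub>0 UNIV" and spl: "splitting Q F\<^sub>0"
    and inf: "infinite (UNIV :: 'r set)" and C: "\<And>t. decseq (C t)"
  obtains F where "F \<le> F\<^sub>0" "\<And>P. P \<in> Q \<Longrightarrow> \<exists>\<^sub>F n in F. n \<in> P"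
    "\<And>t. settled TYPE('c) Q (C t) F"
proof -
  obtain L :: "('r \<times> 'r) set" where L: "wf L" "trans L"
    "\<And>s t. s \<noteq> t \<Longrightarrow> (s, t) \<in> L \<or> (t, s) \<in> L"
    "\<And>t. |{s. (s, t) \<in> L}| <o |UNIV :: 'r set|"
    by (rule cardinal_wellorder_exists) (rule that)
  define H :: "('r \<Rightarrow> 'a filter \<times> 'r set) \<Rightarrow> 'r set \<Rightarrow> 'a filter"
    where "H f S = inf F\<^sub>0 (INF s\<in>S. fst (f s))" for f S
  define U :: "('r \<Rightarrow> 'a filter \<times> 'r set) \<Rightarrow> 'r set \<Rightarrow> 'r set"
    where "U f S = (\<Union>s\<in>S. snd (f s))" for f S
  define before where "before t = {s. (s, t) \<in> L}" for t
  \<comment> \<open>A step assumes that the preceding stages went well; otherwise any value will do, so a step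
    always exists and the recursion can be set up before independence is proved.\<close>
  define step where "step f t v \<longleftrightarrow> finite (snd v) \<and>
    (cell_independent A Q (H f (before t)) (- U f (before t)) \<and> U f (before t) \<noteq> UNIV \<longrightarrow>
      cell_independent A Q (inf (H f (before t)) (fst v)) (- U f (before t) - snd v) \<and>
      settled TYPE('c) Q (C t) (inf (H f (before t)) (fst v)))"
    for f t and v :: "'a filter \<times> 'r set"
  have H_le: "H f S \<le> F\<^sub>0" for f S
    by (simp add: H_def)
  have "\<exists>v. step f t v" for f t
  proof (cases "cell_independent A Q (H f (before t)) (- U f (before t)) \<and> U f (before t) \<noteq> UNIV")
    case True
    then have "\<exists>G W. finite W \<and> cell_independent A Q (inf (H f (before t)) G) (- U f (before t) - W)
        \<and> settled TYPE('c) Q (C t) (inf (H f (before t)) G)"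
      by (intro independent_settle mono linked splitting_mono[OF spl H_le] C) auto
    then obtain G W where "finite W" "cell_independent A Q (inf (H f (before t)) G) (- U f (before t) - W)"
      "settled TYPE('c) Q (C t) (inf (H f (before t)) G)"
      by blast
    then show ?thesis
      unfolding step_def by (intro exI[of _ "(G, W)"]) simp
  next
    case False
    then show ?thesis
      unfolding step_def by (intro exI[of _ "(top, {})"] conjI impI) (simp, blast+)
  qed
  moreover have "step f t v = step g t v" if "\<And>s. (s, t) \<in> L \<Longrightarrow> f s = g s" for f g t v
  proof -
    have "H f (before t) = H g (before t)" "U f (before t) = U g (before t)"
      using that by (auto simp: H_def U_def before_def intro!: arg_cong2[where f = inf] INF_cong)
    then show ?thesis
      by (simp add: step_def)
  qed
  ultimately obtain f where f: "\<And>t. step f t (f t)"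
    using dependent_wf_choice[OF L(1), of step] by blast
  have unused: "U f (before t) \<noteq> UNIV" for t
    unfolding U_def using L(4)[of t] f
    by (intro UN_finite_sets_neq_UNIV inf) (auto simp: before_def step_def)
  have upto: "H f (insert t (before t)) = inf (H f (before t)) (fst (f t))"
    "- U f (insert t (before t)) = - U f (before t) - snd (f t)" for t
    by (auto simp: H_def U_def ac_simps)
  have limit: "cell_independent A Q (H f S) (- U f S)"
    if S: "\<And>s. s \<in> S \<Longrightarrow> before s \<subseteq> S"
      and ind_S: "\<And>s. s \<in> S \<Longrightarrow>
        cell_independent A Q (H f (insert s (before s))) (- U f (insert s (before s)))" for S
    unfolding cell_independent_def
  proof (intro ballI)
    fix P Z assume P: "P \<in> Q" and Z: "Z \<in> cells A (- U f S)"
    show "\<exists>\<^sub>F n in H f S. n \<in> P \<and> n \<in> Z"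
      unfolding frequently_def
    proof
      assume "\<forall>\<^sub>F n in H f S. \<not> (n \<in> P \<and> n \<in> Z)"
      then obtain p q where pq: "eventually p F\<^sub>0" "eventually q (INF s\<in>S. fst (f s))"
        "\<forall>n. p n \<and> q n \<longrightarrow> \<not> (n \<in> P \<and> n \<in> Z)"
        unfolding H_def eventually_inf by blast
      obtain J where J: "J \<subseteq> S" "finite J" "eventually q (INF s\<in>J. fst (f s))"
        using pq(2) unfolding eventually_INF[of _ _ S] by blast
      have ev: "\<forall>\<^sub>F n in H f J. \<not> (n \<in> P \<and> n \<in> Z)"
        unfolding H_def eventually_inf using pq J(3) by blast
      show False
      proof (cases "J = {}")
        case True
        have "\<exists>\<^sub>F n in F\<^sub>0. n \<in> P \<and> n \<in> Z"
          using Z cells_mono[of "- U f S" UNIV A] by (intro cell_independentD[OF ind P]) auto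
        with ev True show False
          by (simp add: H_def frequently_def)
      next
        case False
        then obtain s where s: "s \<in> J" "\<And>s'. s' \<in> J \<Longrightarrow> s' = s \<or> (s', s) \<in> L"
          using finite_has_last[OF L(2,3) J(2)] by blast
        then have "J \<subseteq> insert s (before s)"
          by (auto simp: before_def)
        then have "H f (insert s (before s)) \<le> H f J"
          unfolding H_def by (intro inf_mono order_refl INF_superset_mono) auto
        with ev have "\<forall>\<^sub>F n in H f (insert s (before s)). \<not> (n \<in> P \<and> n \<in> Z)"
          by (rule filter_leD[rotated])
        moreover have "insert s (before s) \<subseteq> S"
          using S s(1) J(1) by auto
        then have "Z \<in> cells A (- U f (insert s (before s)))"
          using Z cells_mono[of "- U f S" "- U f (insert s (before s))" A] by (auto simp: U_def)
        then have "\<exists>\<^sub>F n in H f (insert s (before s)). n \<in> P \<and> n \<in> Z"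
          using s(1) J(1) by (intro cell_independentD[OF ind_S P]) auto
        ultimately show False
          by (simp add: frequently_def)
      qed
    qed
  qed
  have ind_step: "cell_independent A Q (H f (insert t (before t))) (- U f (insert t (before t)))"
    if "cell_independent A Q (H f (before t)) (- U f (before t))" for t
    using f[of t] that unused[of t] by (simp add: step_def upto)
  have ind_before: "cell_independent A Q (H f (before t)) (- U f (before t))" for t
    using L(1)
  proof (induction t rule: wf_induct_rule)
    case (less t)
    show ?case
    proof (rule limit)
      show "before s \<subseteq> before t" if "s \<in> before t" for s
        using that \<open>trans L\<close> by (auto simp: before_def dest: transD)
      show "cell_independent A Q (H f (insert s (before s))) (- U f (insert s (before s)))"
        if "s \<in> before t" for s
        using less that by (intro ind_step) (auto simp: before_def)
    qed
  qed
  show ?thesis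
  proof (rule that[of "H f UNIV"])
    show "H f UNIV \<le> F\<^sub>0" by (rule H_le)
    have "cell_independent A Q (H f UNIV) (- U f UNIV)"
      by (rule limit) (use ind_step ind_before in auto)
    then show "\<exists>\<^sub>F n in H f UNIV. n \<in> P" if "P \<in> Q" for P
      using cell_independentD[OF _ that UNIV_in_cells] by fastforce
    fix t
    have "settled TYPE('c) Q (C t) (inf (H f (before t)) (fst (f t)))"
      using f[of t] ind_before[of t] unused[of t] by (simp add: step_def)
    moreover have "H f UNIV \<le> inf (H f (before t)) (fst (f t))"
      unfolding upto(1)[symmetric] unfolding H_def by (intro inf_mono order_refl INF_superset_mono) auto
    ultimately show "settled TYPE('c) Q (C t) (H f UNIV)"
      by (rule settled_mono)
  qed
qed

section \<open>Ultrafilters and the topology of the remainder\<close>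

lemma ultrafilter_below:
  assumes "F \<noteq> bot"
  shows "\<exists>p. ultrafilter p \<and> p \<le> F"
proof -
  let ?A = "{p. p \<noteq> bot \<and> p \<le> F}"
  have "\<exists>m\<in>?A. \<forall>a\<in>?A. a \<le> m \<longrightarrow> a = m"
  proof (rule predicate_Zorn)
    show "partial_order_on ?A (relation_of (\<lambda>p q. q \<le> p) ?A)"
      by (rule partial_order_on_relation_ofI) auto
    fix C assume "C \<in> Chains (relation_of (\<lambda>p q. q \<le> p) ?A)"
    then have C: "C \<subseteq> ?A" and chain: "\<And>p q. p \<in> C \<Longrightarrow> q \<in> C \<Longrightarrow> p \<le> q \<or> q \<le> p"
      by (auto simp: Chains_def relation_of_def)
    have "Inf (insert F C) \<noteq> bot"
    proof
      assume "Inf (insert F C) = bot"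
      moreover have "eventually (\<lambda>_. False) (Inf (insert F C)) \<longleftrightarrow>
          (\<exists>p\<in>insert F C. eventually (\<lambda>_. False) p)"
      proof (rule eventually_Inf_base)
        fix p q assume pq: "p \<in> insert F C" "q \<in> insert F C"
        then have "p \<le> q \<or> q \<le> p"
          using chain C by blast
        then show "\<exists>x\<in>insert F C. x \<le> inf p q"
          using pq by (meson inf_greatest order_refl)
      qed simp
      ultimately show False
        using C assms by (auto simp: trivial_limit_def)
    qed
    moreover have "Inf (insert F C) \<le> p" if "p \<in> insert F C" for p
      using that by (rule Inf_lower)
    ultimately show "\<exists>u\<in>?A. \<forall>p\<in>C. u \<le> p"
      by (intro bexI[of _ "Inf (insert F C)"]) auto
  qed
  then obtain m where m: "m \<noteq> bot" "m \<le> F" "\<And>p. p \<noteq> bot \<Longrightarrow> p \<le> F \<Longrightarrow> p \<le> m \<Longrightarrow> p = m"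
    by blast
  have "eventually (\<lambda>n. n \<in> A) m" if "\<not> eventually (\<lambda>n. n \<notin> A) m" for A
  proof -
    have "inf m (principal A) \<noteq> bot"
      using that by (simp add: trivial_limit_def eventually_inf_principal)
    then have "inf m (principal A) = m"
      using m(2) by (intro m(3)) (auto intro: le_infI1)
    then have "m \<le> principal A"
      by (metis inf.cobounded2)
    then show ?thesis
      by (simp add: le_principal)
  qed
  then have "ultrafilter m"
    using m(1) unfolding ultrafilter_def by blast
  with m(2) show ?thesis by blast
qed

lemma ultrafilter_below_frequently:
  assumes "\<exists>\<^sub>F n in F. P n"
  shows "\<exists>p. ultrafilter p \<and> p \<le> F \<and> eventually P p"
proof -
  have "inf F (principal {n. P n}) \<noteq> bot"
    using assms by (simp add: trivial_limit_def eventually_inf_principal frequently_def)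
  then obtain p where "ultrafilter p" "p \<le> inf F (principal {n. P n})"
    using ultrafilter_below by blast
  then show ?thesis
    by (auto simp: le_principal)
qed

lemma eventually_iff_ultrafilters:
  "eventually P F \<longleftrightarrow> (\<forall>p. ultrafilter p \<and> p \<le> F \<longrightarrow> eventually P p)"
proof
  assume all: "\<forall>p. ultrafilter p \<and> p \<le> F \<longrightarrow> eventually P p"
  show "eventually P F"
  proof (rule ccontr)
    assume "\<not> eventually P F"
    then have "\<exists>\<^sub>F n in F. \<not> P n"
      by (simp add: frequently_def)
    then obtain p where p: "ultrafilter p" "p \<le> F" "\<forall>\<^sub>F n in p. \<not> P n"
      using ultrafilter_below_frequently by blast
    with all have "\<forall>\<^sub>F n in p. False"
      using eventually_elim2[of P p "\<lambda>n. \<not> P n" "\<lambda>_. False"] by blast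
    with p(1) show False
      by (simp add: ultrafilter_def trivial_limit_def)
  qed
qed (auto intro: filter_leD)

lemma ultrafilter_not:
  assumes "ultrafilter p"
  shows "(\<forall>\<^sub>F n in p. \<not> P n) \<longleftrightarrow> \<not> (\<forall>\<^sub>F n in p. P n)"
proof -
  have "(\<forall>\<^sub>F n in p. P n) \<or> (\<forall>\<^sub>F n in p. \<not> P n)"
    using spec[OF conjunct2[OF assms[unfolded ultrafilter_def]], of "{n. P n}"] by simp
  moreover have False if "\<forall>\<^sub>F n in p. P n" "\<forall>\<^sub>F n in p. \<not> P n"
  proof -
    from that have "\<forall>\<^sub>F n in p. False"
      by eventually_elim simp
    then show False
      using assms by (simp add: ultrafilter_def trivial_limit_def)
  qed
  ultimately show ?thesis by blast
qed

lemma ultrafilter_imp: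
  assumes "ultrafilter p"
  shows "(\<forall>\<^sub>F n in p. P n \<longrightarrow> Q n) \<longleftrightarrow> ((\<forall>\<^sub>F n in p. P n) \<longrightarrow> (\<forall>\<^sub>F n in p. Q n))"
proof -
  have "(\<forall>\<^sub>F n in p. P n \<longrightarrow> Q n) \<longleftrightarrow> \<not> (\<forall>\<^sub>F n in p. P n \<and> \<not> Q n)"
    using ultrafilter_not[OF assms, of "\<lambda>n. P n \<and> \<not> Q n"] by simp
  then show ?thesis
    by (simp add: eventually_conj_iff ultrafilter_not[OF assms])
qed

lemma ultrafilter_iff:
  assumes "ultrafilter p"
  shows "(\<forall>\<^sub>F n in p. P n \<longleftrightarrow> Q n) \<longleftrightarrow> ((\<forall>\<^sub>F n in p. P n) \<longleftrightarrow> (\<forall>\<^sub>F n in p. Q n))"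
  unfolding iff_conv_conj_imp eventually_conj_iff ultrafilter_imp[OF assms] by blast

lemma ultrafilter_bex_finite:
  assumes "ultrafilter p" "finite J" "\<forall>\<^sub>F n in p. \<exists>i\<in>J. P i n"
  shows "\<exists>i\<in>J. \<forall>\<^sub>F n in p. P i n"
proof (rule ccontr)
  assume "\<not> (\<exists>i\<in>J. \<forall>\<^sub>F n in p. P i n)"
  then have "\<forall>\<^sub>F n in p. \<forall>i\<in>J. \<not> P i n"
    using assms(2) by (simp add: eventually_ball_finite ultrafilter_not[OF assms(1)])
  then have "\<forall>\<^sub>F n in p. \<not> (\<exists>i\<in>J. P i n)"
    by simp
  with assms(3) show False
    using ultrafilter_not[OF assms(1), of "\<lambda>n. \<exists>i\<in>J. P i n"] by simp
qed

lemma ultrafilter_filtermap: "ultrafilter p \<Longrightarrow> ultrafilter (filtermap f p)"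
  using ultrafilter_not[of p]
  by (auto simp: ultrafilter_def eventually_filtermap filtermap_bot_iff)

lemma ultrafilter_eqI:
  assumes "ultrafilter p" "ultrafilter q"
    and "\<And>A. (\<forall>\<^sub>F n in p. n \<in> A) \<longleftrightarrow> (\<forall>\<^sub>F n in q. n \<in> A)"
  shows "p = q"
proof (rule filter_eqI)
  show "eventually P p \<longleftrightarrow> eventually P q" for P
    using assms(3)[of "{n. P n}"] by simp
qed

lemma topspace_omega_star_iff: "p \<in> topspace omega_star \<longleftrightarrow> ultrafilter p \<and> p \<le> cofinite"
proof
  assume p: "p \<in> topspace omega_star"
  have u: "ultrafilter p" and nonprincipal: "p \<noteq> principal {k}" for k
    using p by (auto simp: topspace_omega_star)
  have ne: "\<forall>\<^sub>F n in p. n \<noteq> k" for k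
  proof (rule ccontr)
    assume "\<not> (\<forall>\<^sub>F n in p. n \<noteq> k)"
    then have k: "\<forall>\<^sub>F n in p. n = k"
      using ultrafilter_not[OF u, of "\<lambda>n. n = k"] by simp
    have "eventually P p \<longleftrightarrow> P k" for P
    proof -
      have "eventually P p \<longleftrightarrow> (\<forall>\<^sub>F n in p. P k)"
        by (rule eventually_subst) (use k in \<open>auto elim: eventually_mono\<close>)
      then show ?thesis
        using u by (cases "P k") (auto simp: ultrafilter_def trivial_limit_def)
    qed
    then have "p = principal {k}"
      by (simp add: filter_eq_iff eventually_principal)
    with nonprincipal show False by blast
  qed
  have "eventually P p" if "finite {n. \<not> P n}" for P
  proof -
    have "\<forall>\<^sub>F n in p. \<forall>k\<in>{n. \<not> P n}. n \<noteq> k"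
      using that ne by (intro eventually_ball_finite) auto
    then show ?thesis
      by (rule eventually_mono) auto
  qed
  with u show "ultrafilter p \<and> p \<le> cofinite"
    by (simp add: le_filter_def eventually_cofinite)
next
  assume "ultrafilter p \<and> p \<le> cofinite"
  then have "p \<in> K_set cofinite"
    by (simp add: K_set_def topspace_beta_omega)
  then show "p \<in> topspace omega_star"
    using K_set_subset_omega_star by blast
qed

lemma K_set_iff: "p \<in> K_set F \<longleftrightarrow> ultrafilter p \<and> p \<le> F"
  by (simp add: K_set_def topspace_beta_omega)

lemma openin_beta_omega:
  "openin beta_omega U \<longleftrightarrow> (\<forall>p\<in>U. ultrafilter p \<and>
     (\<exists>A. (\<forall>\<^sub>F n in p. n \<in> A) \<and> (\<forall>q. ultrafilter q \<and> (\<forall>\<^sub>F n in q. n \<in> A) \<longrightarrow> q \<in> U)))"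
    (is "_ \<longleftrightarrow> ?R U")
proof
  assume "openin beta_omega U"
  then have "generate_topology_on (range (\<lambda>A. {p. ultrafilter p \<and> (\<forall>\<^sub>F n in p. n \<in> A)})) U"
    by (simp add: beta_omega_def openin_topology_generated_by_iff)
  then show "?R U"
  proof induction
    case (Int U V)
    show ?case
    proof (intro ballI conjI)
      fix p assume p: "p \<in> U \<inter> V"
      then show "ultrafilter p" using Int by blast
      obtain A where A: "\<forall>\<^sub>F n in p. n \<in> A" "\<And>q. ultrafilter q \<Longrightarrow> \<forall>\<^sub>F n in q. n \<in> A \<Longrightarrow> q \<in> U"
        using Int.IH(1) p by blast
      obtain B where B: "\<forall>\<^sub>F n in p. n \<in> B" "\<And>q. ultrafilter q \<Longrightarrow> \<forall>\<^sub>F n in q. n \<in> B \<Longrightarrow> q \<in> V"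
        using Int.IH(2) p by blast
      show "\<exists>A. (\<forall>\<^sub>F n in p. n \<in> A) \<and> (\<forall>q. ultrafilter q \<and> (\<forall>\<^sub>F n in q. n \<in> A) \<longrightarrow> q \<in> U \<inter> V)"
        using A B by (intro exI[of _ "A \<inter> B"]) (simp add: eventually_conj_iff)
    qed
  next
    case (UN \<U>)
    then show ?case by (meson Union_iff)
  qed auto
next
  assume R: "?R U"
  have "\<exists>V. openin beta_omega V \<and> p \<in> V \<and> V \<subseteq> U" if p: "p \<in> U" for p
  proof -
    obtain A where A: "\<forall>\<^sub>F n in p. n \<in> A" "\<And>q. ultrafilter q \<Longrightarrow> \<forall>\<^sub>F n in q. n \<in> A \<Longrightarrow> q \<in> U"
      using R p by blast
    have "openin beta_omega {q. ultrafilter q \<and> (\<forall>\<^sub>F n in q. n \<in> A)}"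
      unfolding beta_omega_def by (rule topology_generated_by_Basis) blast
    with A R p show ?thesis by blast
  qed
  then show "openin beta_omega U"
    using openin_subopen by metis
qed

lemma openin_omega_star:
  "openin omega_star U \<longleftrightarrow> U \<subseteq> topspace omega_star \<and>
     (\<forall>p\<in>U. \<exists>A. (\<forall>\<^sub>F n in p. n \<in> A) \<and> (\<forall>q\<in>topspace omega_star. (\<forall>\<^sub>F n in q. n \<in> A) \<longrightarrow> q \<in> U))"
    (is "_ \<longleftrightarrow> ?R U")
proof
  assume "openin omega_star U"
  then obtain T where T: "openin beta_omega T"
    "U = T \<inter> (topspace beta_omega - range (\<lambda>n. principal {n}))"
    unfolding omega_star_def openin_subtopology by blast
  have "topspace omega_star = topspace beta_omega - range (\<lambda>n. principal {n})"
    by (auto simp: omega_star_def)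
  then have U: "U = T \<inter> topspace omega_star"
    using T(2) by simp
  have "\<exists>A. (\<forall>\<^sub>F n in p. n \<in> A) \<and> (\<forall>q\<in>topspace omega_star. (\<forall>\<^sub>F n in q. n \<in> A) \<longrightarrow> q \<in> U)" if "p \<in> U" for p
  proof -
    obtain A where A: "\<forall>\<^sub>F n in p. n \<in> A" "\<And>q. ultrafilter q \<Longrightarrow> \<forall>\<^sub>F n in q. n \<in> A \<Longrightarrow> q \<in> T"
      using T(1) \<open>p \<in> U\<close> unfolding openin_beta_omega U by blast
    then show ?thesis
      by (auto simp: U topspace_omega_star_iff)
  qed
  then show "?R U" using U by blast
next
  assume R: "?R U"
  define T where "T = \<Union>{{q. ultrafilter q \<and> (\<forall>\<^sub>F n in q. n \<in> A)} | A.
    \<forall>q\<in>topspace omega_star. (\<forall>\<^sub>F n in q. n \<in> A) \<longrightarrow> q \<in> U}"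
  have "openin beta_omega T"
    unfolding T_def beta_omega_def by (rule openin_Union) (auto intro!: topology_generated_by_Basis)
  moreover have "U = T \<inter> (topspace beta_omega - range (\<lambda>n. principal {n}))"
  proof -
    have *: "topspace omega_star = topspace beta_omega - range (\<lambda>n. principal {n})"
      by (auto simp: omega_star_def)
    show ?thesis
      unfolding *[symmetric]
    proof (intro equalityI subsetI)
      fix p assume p: "p \<in> U"
      then obtain A where "\<forall>\<^sub>F n in p. n \<in> A" "\<forall>q\<in>topspace omega_star. (\<forall>\<^sub>F n in q. n \<in> A) \<longrightarrow> q \<in> U"
        using R by blast
      moreover have "p \<in> topspace omega_star" "ultrafilter p"
        using p R by (auto simp: topspace_omega_star_iff)
      ultimately show "p \<in> T \<inter> topspace omega_star"
        unfolding T_def by blast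
    next
      fix p assume "p \<in> T \<inter> topspace omega_star"
      then show "p \<in> U" unfolding T_def by blast
    qed
  qed
  ultimately show "openin omega_star U"
    unfolding omega_star_def openin_subtopology by blast
qed

lemma openin_omega_star_basic: "openin omega_star {p \<in> topspace omega_star. \<forall>\<^sub>F n in p. n \<in> A}"
  unfolding openin_omega_star by blast

section \<open>Weak P-sets\<close>

lemma uncountable_nat_sets: "uncountable (UNIV :: nat set set)"
proof
  assume "countable (UNIV :: nat set set)"
  then have "range (from_nat_into (UNIV :: nat set set)) = UNIV"
    by (intro range_from_nat_into) auto
  then have "\<exists>f :: nat \<Rightarrow> nat set. f ` UNIV = Pow UNIV"
    by auto
  then show False
    using Cantors_theorem by blast
qed

text \<open>
  Given points \<open>d m\<close> outside \<open>K_set F\<close>, choose \<open>C\<close> decreasing in \<open>F\<close> with \<open>C m\<close> not in \<open>d m\<close>. If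
  \<open>m + 1\<close> of the sets \<open>V y\<close> were in \<open>d m\<close>, their intersection would be almost contained in \<open>C m\<close>, which
  would put \<open>C m\<close> into \<open>d m\<close>. So each \<open>d m\<close> contains finitely many of the sets \<open>V y\<close>, and as there are
  uncountably many columns, some \<open>V y\<close> is in no \<open>d m\<close>.
\<close>

lemma weak_P_set_K_set:
  fixes F :: "nat filter"
  assumes free: "F \<le> cofinite" and unc: "uncountable (UNIV :: 'c set)"
    and ok: "\<And>C. decseq C \<Longrightarrow> (\<And>k. \<forall>\<^sub>F n in F. n \<in> C k) \<Longrightarrow>
      \<exists>V :: 'c \<Rightarrow> nat set. (\<forall>y. \<forall>\<^sub>F n in F. n \<in> V y) \<and>
        (\<forall>Y k. card Y = Suc k \<longrightarrow> finite {n. (\<forall>y\<in>Y. n \<in> V y) \<and> n \<notin> C k})"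
  shows "weak_P_set omega_star (K_set F)"
proof -
  have escape: "\<exists>U. (\<forall>\<^sub>F n in F. n \<in> U) \<and> (\<forall>\<^sub>F n in p. n \<notin> U)"
    if p: "p \<in> topspace omega_star - K_set F" for p
  proof -
    have u: "ultrafilter p" and "\<not> p \<le> F"
      using p by (auto simp: topspace_omega_star_iff K_set_iff)
    then obtain P where "eventually P F" "\<not> eventually P p"
      by (auto simp: le_filter_def)
    then show ?thesis
      using ultrafilter_not[OF u, of P] by (intro exI[of _ "{n. P n}"]) simp
  qed
  have "openin omega_star (topspace omega_star - K_set F)"
    unfolding openin_omega_star
  proof (intro conjI ballI)
    fix p assume "p \<in> topspace omega_star - K_set F"
    then obtain U where U: "\<forall>\<^sub>F n in F. n \<in> U" "\<forall>\<^sub>F n in p. n \<notin> U"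
      using escape by blast
    have "q \<notin> K_set F" if q: "q \<in> topspace omega_star" "\<forall>\<^sub>F n in q. n \<in> - U" for q
    proof
      assume "q \<in> K_set F"
      then have "\<forall>\<^sub>F n in q. n \<in> U"
        using U(1) by (auto simp: K_set_iff intro: filter_leD)
      with q show False
        using ultrafilter_not[of q "\<lambda>n. n \<in> U"] by (simp add: topspace_omega_star_iff)
    qed
    with U(2) show "\<exists>A. (\<forall>\<^sub>F n in p. n \<in> A) \<and> (\<forall>q\<in>topspace omega_star.
        (\<forall>\<^sub>F n in q. n \<in> A) \<longrightarrow> q \<in> topspace omega_star - K_set F)"
      by (intro exI[of _ "- U"]) auto
  qed blast
  then have "closedin omega_star (K_set F)"
    using K_set_subset_omega_star[OF free] by (simp add: closedin_def)
  moreover have "omega_star closure_of D \<inter> K_set F = {}"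
    if D: "countable D" "D \<subseteq> topspace omega_star - K_set F" for D
  proof (cases "D = {}")
    case False
    define d where "d = from_nat_into D"
    have range_d: "range d = D"
      unfolding d_def using D(1) False by (rule range_from_nat_into[rotated])
    then have d: "d m \<in> topspace omega_star - K_set F" for m
      using D(2) by blast
    then have "\<forall>m. \<exists>U. (\<forall>\<^sub>F n in F. n \<in> U) \<and> (\<forall>\<^sub>F n in d m. n \<notin> U)"
      using escape by blast
    then obtain U where U: "\<And>m. \<forall>\<^sub>F n in F. n \<in> U m" "\<And>m. \<forall>\<^sub>F n in d m. n \<notin> U m"
      unfolding choice_iff by blast
    define C where "C k = {n. \<forall>m\<in>{..k}. n \<in> U m}" for k
    have "decseq C"
      by (auto simp: C_def decseq_def)
    moreover have "\<forall>\<^sub>F n in F. n \<in> C k" for k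
      using U(1) by (simp add: C_def eventually_ball_finite)
    ultimately obtain V :: "'c \<Rightarrow> nat set" where V: "\<And>y. \<forall>\<^sub>F n in F. n \<in> V y"
      "\<And>Y k. card Y = Suc k \<Longrightarrow> finite {n. (\<forall>y\<in>Y. n \<in> V y) \<and> n \<notin> C k}"
      using ok by meson
    have "finite {y. \<forall>\<^sub>F n in d m. n \<in> V y}" for m
    proof (rule ccontr)
      assume "infinite {y. \<forall>\<^sub>F n in d m. n \<in> V y}"
      then obtain Y where Y: "finite Y" "card Y = Suc m" "Y \<subseteq> {y. \<forall>\<^sub>F n in d m. n \<in> V y}"
        using infinite_arbitrarily_large by metis
      have "\<forall>\<^sub>F n in d m. \<forall>y\<in>Y. n \<in> V y"
        using Y by (intro eventually_ball_finite) auto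
      moreover have "\<forall>\<^sub>F n in d m. n \<notin> C m"
        using U(2)[of m] by (auto simp: C_def elim: eventually_mono)
      moreover have "\<forall>\<^sub>F n in cofinite. \<not> ((\<forall>y\<in>Y. n \<in> V y) \<and> n \<notin> C m)"
        using V(2)[OF Y(2)] by (simp add: eventually_cofinite)
      then have "\<forall>\<^sub>F n in d m. \<not> ((\<forall>y\<in>Y. n \<in> V y) \<and> n \<notin> C m)"
        using d[of m] by (auto simp: topspace_omega_star_iff intro: filter_leD)
      ultimately have "\<forall>\<^sub>F n in d m. False"
        by eventually_elim blast
      then show False
        using d[of m] by (simp add: topspace_omega_star_iff ultrafilter_def trivial_limit_def)
    qed
    then have "countable (\<Union>m. {y. \<forall>\<^sub>F n in d m. n \<in> V y})"
      by (intro countable_UN) (auto intro: countable_finite)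
    then have "(\<Union>m. {y. \<forall>\<^sub>F n in d m. n \<in> V y}) \<noteq> UNIV"
      using unc by metis
    then obtain y where y: "\<And>m. \<not> (\<forall>\<^sub>F n in d m. n \<in> V y)"
      by blast
    show ?thesis
    proof (rule ccontr)
      assume "omega_star closure_of D \<inter> K_set F \<noteq> {}"
      then obtain p where p: "p \<in> omega_star closure_of D" "p \<in> K_set F"
        by blast
      let ?O = "{q \<in> topspace omega_star. \<forall>\<^sub>F n in q. n \<in> V y}"
      have "p \<in> ?O"
        using p(2) V(1)[of y] K_set_subset_omega_star[OF free]
        by (auto simp: K_set_iff intro: filter_leD)
      then have "\<exists>q. q \<in> D \<and> q \<in> ?O"
        using p(1)[unfolded in_closure_of, THEN conjunct2, THEN spec[of _ ?O]]
          openin_omega_star_basic[of "V y"] by (elim impE) (rule conjI)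
      then obtain q where "q \<in> D" "q \<in> ?O"
        by (elim exE conjE) (rule that)
      moreover from \<open>q \<in> D\<close> obtain m where "q = d m"
        unfolding range_d[symmetric] by (rule rangeE)
      ultimately show False
        using y[of m] by simp
    qed
  qed simp
  ultimately show ?thesis
    unfolding weak_P_set_def by blast
qed

section \<open>Small sets that tie a permutation to the blocks\<close>

text \<open>
  A point and its image cannot both lie in this set unless they are in the same block: membership of
  \<open>n\<close> says that \<open>f n\<close> is in no earlier block, membership of \<open>f n\<close> that \<open>n\<close> is in no earlier block.
\<close>

definition block_rising :: "(nat \<Rightarrow> nat) \<Rightarrow> (nat \<Rightarrow> nat) \<Rightarrow> nat set" where
  "block_rising \<pi> f = {n. \<pi> n \<le> \<pi> (f n) \<and> \<pi> n \<le> \<pi> (inv f n)}"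

definition block_filter :: "(nat \<Rightarrow> nat) \<Rightarrow> nat filter" where
  "block_filter \<pi> = inf cofinite (INF f\<in>{f. bij f}. principal (block_rising \<pi> f))"

lemma block_rising_preserves_block:
  assumes "bij f" "n \<in> block_rising \<pi> f" "f n \<in> block_rising \<pi> f"
  shows "\<pi> (f n) = \<pi> n"
proof -
  have "inv f (f n) = n"
    using assms(1) by (simp add: bij_is_inj)
  then show ?thesis
    using assms(2,3) by (auto simp: block_rising_def intro: antisym)
qed

lemma eventually_block_rising:
  assumes "bij f"
  shows "\<forall>\<^sub>F n in block_filter \<pi>. n \<in> block_rising \<pi> f"
proof -
  have "\<forall>\<^sub>F n in (INF f\<in>{f. bij f}. principal (block_rising \<pi> f)). n \<in> block_rising \<pi> f"
    using assms by (intro eventually_INF1[of f]) (auto simp: eventually_principal)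
  then show ?thesis
    unfolding block_filter_def by (rule filter_leD[OF inf_le2])
qed

lemma card_not_block_rising:
  assumes "bij f" "finite {n. \<pi> n < k}"
  shows "finite {n. \<pi> n = k \<and> n \<notin> block_rising \<pi> f}"
    and "card {n. \<pi> n = k \<and> n \<notin> block_rising \<pi> f} \<le> 2 * card {n. \<pi> n < k}"
proof -
  let ?T = "{n. \<pi> n < k}"
  have fin: "finite (g -` ?T)" and card: "card (g -` ?T) \<le> card ?T" if "bij g" for g
  proof -
    have inj: "inj g" using that by (rule bij_is_inj)
    then show "finite (g -` ?T)"
      using assms(2) by (intro finite_vimageI)
    show "card (g -` ?T) \<le> card ?T"
      using inj assms(2) by (intro card_inj_on_le[of g]) (auto intro: inj_on_subset)
  qed
  have sub: "{n. \<pi> n = k \<and> n \<notin> block_rising \<pi> f} \<subseteq> f -` ?T \<union> inv f -` ?T"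
    by (auto simp: block_rising_def)
  have bij: "bij (inv f)"
    using assms(1) by (rule bij_imp_bij_inv)
  show "finite {n. \<pi> n = k \<and> n \<notin> block_rising \<pi> f}"
    using sub fin[OF assms(1)] fin[OF bij] by (meson finite_UnI finite_subset)
  have "card {n. \<pi> n = k \<and> n \<notin> block_rising \<pi> f} \<le> card (f -` ?T \<union> inv f -` ?T)"
    using sub fin[OF assms(1)] fin[OF bij] by (intro card_mono) auto
  also have "\<dots> \<le> card (f -` ?T) + card (inv f -` ?T)"
    by (rule card_Un_le)
  also have "\<dots> \<le> 2 * card ?T"
    using card[OF assms(1)] card[OF bij] by simp
  finally show "card {n. \<pi> n = k \<and> n \<notin> block_rising \<pi> f} \<le> 2 * card ?T" .
qed

text \<open>
  A count in one late block \<open>k\<close>. The sets of finitely many permutations, at most \<open>k\<close> in number, omit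
  at most \<open>2 * k * card {n. \<pi> n < k}\<close> points of the block, fewer than the cell has there. The block
  lies inside \<open>P\<close> as soon as \<open>k\<close> is in \<open>S\<close>, and \<open>S\<close> contains arbitrarily late \<open>k\<close>.
\<close>

lemma cell_independent_block_filter:
  assumes fin: "\<And>k. finite {n. \<pi> n < k}"
    and large: "\<And>Z. Z \<in> cells A UNIV \<Longrightarrow>
           \<forall>\<^sub>F k in sequentially. 2 * k * card {n. \<pi> n < k} < card {n \<in> Z. \<pi> n = k}"
    and Q: "\<And>P. P \<in> Q \<Longrightarrow> \<exists>S. infinite S \<and> P = \<pi> -` S"
  shows "cell_independent A Q (block_filter \<pi>) UNIV"
  unfolding cell_independent_def frequently_def
proof (intro ballI notI)
  fix P Z assume P: "P \<in> Q" and Z: "Z \<in> cells A UNIV"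
    and ev: "\<forall>\<^sub>F n in block_filter \<pi>. \<not> (n \<in> P \<and> n \<in> Z)"
  obtain J where J: "finite J" "J \<subseteq> {f. bij f}"
    "\<forall>\<^sub>F n in cofinite. (\<forall>f\<in>J. n \<in> block_rising \<pi> f) \<longrightarrow> \<not> (n \<in> P \<and> n \<in> Z)"
    using ev unfolding block_filter_def by (rule eventually_inf_INF_principal)
  define N where "N = {n. (\<forall>f\<in>J. n \<in> block_rising \<pi> f) \<and> n \<in> P \<and> n \<in> Z}"
  have "finite N"
    using J(3) by (simp add: eventually_cofinite N_def)
  obtain S where S: "infinite S" "P = \<pi> -` S"
    using Q[OF P] by blast
  have "\<forall>\<^sub>F k in sequentially. \<forall>n\<in>N. \<pi> n < k"
    using \<open>finite N\<close> by (intro eventually_ball_finite ballI eventually_gt_at_top)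
  with large[OF Z] eventually_ge_at_top[of "card J"]
  have "\<forall>\<^sub>F k in sequentially. 2 * k * card {n. \<pi> n < k} < card {n \<in> Z. \<pi> n = k} \<and>
      card J \<le> k \<and> (\<forall>n\<in>N. \<pi> n < k)"
    by eventually_elim blast
  then obtain k0 where k0: "\<And>k. k \<ge> k0 \<Longrightarrow>
      2 * k * card {n. \<pi> n < k} < card {n \<in> Z. \<pi> n = k} \<and> card J \<le> k \<and> (\<forall>n\<in>N. \<pi> n < k)"
    unfolding eventually_sequentially by blast
  obtain k where k: "k \<ge> k0" "k \<in> S"
    using S(1) unfolding infinite_nat_iff_unbounded_le by blast
  let ?bad = "\<lambda>f. {n. \<pi> n = k \<and> n \<notin> block_rising \<pi> f}"
  have bad: "finite (?bad f)" "card (?bad f) \<le> 2 * card {n. \<pi> n < k}" if "f \<in> J" for f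
    using that J(2) card_not_block_rising[OF _ fin, of f] by auto
  have "{n \<in> Z. \<pi> n = k} \<subseteq> (\<Union>f\<in>J. ?bad f)"
  proof
    fix n assume n: "n \<in> {n \<in> Z. \<pi> n = k}"
    then have "n \<notin> N"
      using k0[OF k(1)] by auto
    then show "n \<in> (\<Union>f\<in>J. ?bad f)"
      using n k(2) S(2) by (auto simp: N_def)
  qed
  then have "card {n \<in> Z. \<pi> n = k} \<le> card (\<Union>f\<in>J. ?bad f)"
    using J(1) bad(1) by (intro card_mono) auto
  also have "\<dots> \<le> (\<Sum>f\<in>J. card (?bad f))"
    using J(1) by (rule card_UN_le)
  also have "\<dots> \<le> card J * (2 * card {n. \<pi> n < k})"
    using sum_bounded_above[of J "\<lambda>f. card (?bad f)", OF bad(2)] by simp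
  also have "\<dots> \<le> k * (2 * card {n. \<pi> n < k})"
    using k0[OF k(1)] by (intro mult_right_mono) auto
  also have "\<dots> < card {n \<in> Z. \<pi> n = k}"
    using k0[OF k(1)] by (simp add: mult.left_commute mult.assoc)
  finally show False by simp
qed

section \<open>Coding clopen subsets of the image\<close>

abbreviation clopenin :: "'a topology \<Rightarrow> 'a set \<Rightarrow> bool" where
  "clopenin X b \<equiv> openin X b \<and> closedin X b"

text \<open>
  Every free ultrafilter contains a set whose basic open set lies inside \<open>U\<close> or inside its complement.
  By compactness, finitely many such sets cover \<open>\<omega>\<close> up to a finite set, and the union of those that
  lie inside \<open>U\<close> is the code.
\<close>

lemma clopenin_omega_star_coded:
  assumes "clopenin omega_star U"
  shows "\<exists>A. \<forall>p\<in>topspace omega_star. p \<in> U \<longleftrightarrow> (\<forall>\<^sub>F n in p. n \<in> A)"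
proof -
  define inside where "inside S B \<longleftrightarrow>
    (\<forall>q\<in>topspace omega_star. (\<forall>\<^sub>F n in q. n \<in> B) \<longrightarrow> q \<in> S)" for S B
  define \<B> where "\<B> = {B. inside U B \<or> inside (topspace omega_star - U) B}"
  have nbhd: "\<exists>B\<in>\<B>. \<forall>\<^sub>F n in p. n \<in> B" if "p \<in> topspace omega_star" for p
  proof -
    have U: "openin omega_star U" "openin omega_star (topspace omega_star - U)"
      using assms by auto
    show ?thesis
    proof (cases "p \<in> U")
      case True
      then show ?thesis
        using U(1) unfolding openin_omega_star \<B>_def inside_def by blast
    next
      case False
      then have "p \<in> topspace omega_star - U"
        using that by blast
      then show ?thesis
        using U(2) unfolding openin_omega_star \<B>_def inside_def by blast
    qed
  qed
  have "inf cofinite (INF B\<in>\<B>. principal (- B)) = bot"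
  proof (rule ccontr)
    assume "inf cofinite (INF B\<in>\<B>. principal (- B)) \<noteq> bot"
    then obtain p where p: "ultrafilter p" "p \<le> inf cofinite (INF B\<in>\<B>. principal (- B))"
      using ultrafilter_below by blast
    then obtain B where "B \<in> \<B>" "\<forall>\<^sub>F n in p. n \<in> B"
      using nbhd[of p] by (auto simp: topspace_omega_star_iff)
    moreover have "p \<le> principal (- B)"
      using p(2) \<open>B \<in> \<B>\<close> by (simp add: le_INF_iff)
    ultimately show False
      using ultrafilter_not[OF p(1), of "\<lambda>n. n \<in> B"] by (simp add: le_principal)
  qed
  then have "eventually (\<lambda>_. False) (inf cofinite (INF B\<in>\<B>. principal (- B)))"
    by simp
  then obtain J where J: "finite J" "J \<subseteq> \<B>" "\<forall>\<^sub>F n in cofinite. (\<forall>B\<in>J. n \<in> - B) \<longrightarrow> False"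
    by (rule eventually_inf_INF_principal)
  have cover: "\<exists>B\<in>J. \<forall>\<^sub>F n in p. n \<in> B" if "p \<in> topspace omega_star" for p
    using that J by (intro ultrafilter_bex_finite) (auto simp: topspace_omega_star_iff intro: filter_leD)
  show ?thesis
  proof (intro exI[of _ "\<Union>{B \<in> J. inside U B}"] ballI)
    fix p assume p: "p \<in> topspace omega_star"
    then have u: "ultrafilter p"
      by (simp add: topspace_omega_star_iff)
    show "p \<in> U \<longleftrightarrow> (\<forall>\<^sub>F n in p. n \<in> \<Union>{B \<in> J. inside U B})"
    proof
      assume "p \<in> U"
      obtain B where B: "B \<in> J" "\<forall>\<^sub>F n in p. n \<in> B"
        using cover[OF p] by blast
      then have "inside U B"
        using J(2) p \<open>p \<in> U\<close> unfolding \<B>_def inside_def by blast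
      then show "\<forall>\<^sub>F n in p. n \<in> \<Union>{B \<in> J. inside U B}"
        using B by (auto elim: eventually_mono)
    next
      assume "\<forall>\<^sub>F n in p. n \<in> \<Union>{B \<in> J. inside U B}"
      then have "\<forall>\<^sub>F n in p. \<exists>B\<in>{B \<in> J. inside U B}. n \<in> B"
        by (rule eventually_mono) auto
      then have "\<exists>B\<in>{B \<in> J. inside U B}. \<forall>\<^sub>F n in p. n \<in> B"
        using J(1) by (intro ultrafilter_bex_finite[OF u]) auto
      then show "p \<in> U"
        using p unfolding inside_def by blast
    qed
  qed
qed

lemma clopen_base_of_extremally_disconnected:
  assumes X: "Hausdorff_space X" "compact_space X" "extremally_disconnected_space X"
    and U: "openin X U" "x \<in> U"
  obtains b where "clopenin X b" "x \<in> b" "b \<subseteq> U"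
proof -
  have "regular_space X"
    using X by (simp add: compact_Hausdorff_imp_regular_space)
  moreover have "closedin X (topspace X - U)" "x \<in> topspace X - (topspace X - U)"
    using U openin_subset by auto
  ultimately obtain V where V: "openin X V" "x \<in> V" "disjnt (topspace X - U) (X closure_of V)"
    unfolding regular_space by meson
  show ?thesis
  proof (rule that[of "X closure_of V"])
    show "clopenin X (X closure_of V)"
      using X(3) V(1) by (simp add: extremally_disconnected_space_def)
    show "x \<in> X closure_of V"
      using closure_of_subset[OF openin_subset[OF V(1)]] V(2) by blast
    show "X closure_of V \<subseteq> U"
      using V(3) closure_of_subset_topspace[of X V] by (auto simp: disjnt_def)
  qed
qed

text \<open>
  The fibres of \<open>\<pi>\<close> are the blocks. Because they are finite, \<open>\<pi>\<close> takes free ultrafilters to free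
  ultrafilters, the only ones for which the codes \<open>a b\<close> are meaningful.
\<close>

locale coded_image =
  fixes X :: "'a topology" and \<phi> :: "nat filter \<Rightarrow> 'a" and a :: "'a set \<Rightarrow> nat set" and \<pi> :: "nat \<Rightarrow> nat"
  assumes Hausdorff: "Hausdorff_space X" and compact: "compact_space X"
    and ed: "extremally_disconnected_space X"
    and cont: "continuous_map omega_star X \<phi>"
    and onto: "\<phi> ` topspace omega_star = topspace X"
    and code: "\<And>b p. clopenin X b \<Longrightarrow> p \<in> topspace omega_star \<Longrightarrow> \<phi> p \<in> b \<longleftrightarrow> (\<forall>\<^sub>F n in p. n \<in> a b)"
    and finite_fibres: "\<And>k. finite {n. \<pi> n < k}"
begin

definition \<Psi> :: "nat filter \<Rightarrow> 'a" where
  "\<Psi> p = \<phi> (filtermap \<pi> p)"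

lemma filtermap_\<pi>_omega_star:
  assumes "p \<in> topspace omega_star"
  shows "filtermap \<pi> p \<in> topspace omega_star"
proof -
  have "filtermap \<pi> cofinite \<le> cofinite"
  proof (rule filter_leI)
    fix P assume "\<forall>\<^sub>F n :: nat in cofinite. P n"
    then have fin: "finite {k. \<not> P k}"
      by (simp add: eventually_cofinite)
    have "{n. \<not> P (\<pi> n)} \<subseteq> {n. \<pi> n < Suc (Max {k. \<not> P k})}"
      using fin by (auto simp: less_Suc_eq_le)
    then have "finite {n. \<not> P (\<pi> n)}"
      by (rule finite_subset) (rule finite_fibres)
    then show "eventually P (filtermap \<pi> cofinite)"
      by (simp add: eventually_filtermap eventually_cofinite)
  qed
  then show ?thesis
    using assms filtermap_mono[of p cofinite \<pi>]
    by (auto simp: topspace_omega_star_iff intro: ultrafilter_filtermap order_trans)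
qed

lemma \<Psi>_in_clopen:
  assumes "clopenin X b" "p \<in> topspace omega_star"
  shows "\<Psi> p \<in> b \<longleftrightarrow> (\<forall>\<^sub>F n in p. \<pi> n \<in> a b)"
  using code[OF assms(1) filtermap_\<pi>_omega_star[OF assms(2)]]
  by (simp add: \<Psi>_def eventually_filtermap)

lemma \<Psi>_in_topspace: "p \<in> topspace omega_star \<Longrightarrow> \<Psi> p \<in> topspace X"
  using onto filtermap_\<pi>_omega_star unfolding \<Psi>_def by blast

lemma continuous_\<Psi>: "continuous_map omega_star X \<Psi>"
proof -
  have "continuous_map omega_star omega_star (filtermap \<pi>)"
    unfolding continuous_map_def
  proof (intro conjI allI impI)
    show "filtermap \<pi> \<in> topspace omega_star \<rightarrow> topspace omega_star"
      using filtermap_\<pi>_omega_star by blast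
    fix U assume U: "openin omega_star U"
    show "openin omega_star {p \<in> topspace omega_star. filtermap \<pi> p \<in> U}"
      unfolding openin_omega_star
    proof (intro conjI ballI)
      fix p assume "p \<in> {p \<in> topspace omega_star. filtermap \<pi> p \<in> U}"
      then obtain A where "\<forall>\<^sub>F n in filtermap \<pi> p. n \<in> A"
        "\<And>q. q \<in> topspace omega_star \<Longrightarrow> \<forall>\<^sub>F n in q. n \<in> A \<Longrightarrow> q \<in> U"
        using U unfolding openin_omega_star by blast
      then show "\<exists>A. (\<forall>\<^sub>F n in p. n \<in> A) \<and> (\<forall>q\<in>topspace omega_star.
          (\<forall>\<^sub>F n in q. n \<in> A) \<longrightarrow> q \<in> {p \<in> topspace omega_star. filtermap \<pi> p \<in> U})"
        using filtermap_\<pi>_omega_star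
        by (intro exI[of _ "\<pi> -` A"]) (simp add: eventually_filtermap)
    qed blast
  qed
  from continuous_map_compose[OF this cont] show ?thesis
    by (simp add: \<Psi>_def[abs_def] o_def)
qed

lemma infinite_code:
  assumes "clopenin X b" "b \<noteq> {}"
  shows "infinite (a b)"
proof
  assume fin: "finite (a b)"
  obtain x where x: "x \<in> b" "x \<in> topspace X"
    using assms openin_subset by blast
  then obtain p where p: "p \<in> topspace omega_star" "\<phi> p = x"
    using onto by (metis imageE)
  then have "\<forall>\<^sub>F n in p. n \<in> a b"
    using code assms(1) x by blast
  moreover have "\<forall>\<^sub>F n in p. n \<notin> a b"
    using p(1) fin by (auto simp: topspace_omega_star_iff eventually_cofinite intro!: filter_leD[of p cofinite])
  ultimately show False
    using p(1) ultrafilter_not[of p "\<lambda>n. n \<in> a b"] by (simp add: topspace_omega_star_iff)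
qed

lemma code_Int:
  assumes "clopenin X b" "clopenin X c"
  shows "\<forall>\<^sub>F n in cofinite. \<pi> n \<in> a (b \<inter> c) \<longleftrightarrow> \<pi> n \<in> a b \<and> \<pi> n \<in> a c"
  unfolding eventually_iff_ultrafilters[of _ cofinite]
proof (intro allI impI)
  fix p :: "nat filter" assume p: "ultrafilter p \<and> p \<le> cofinite"
  then have p': "p \<in> topspace omega_star"
    by (simp add: topspace_omega_star_iff)
  have "clopenin X (b \<inter> c)"
    using assms by auto
  then show "\<forall>\<^sub>F n in p. \<pi> n \<in> a (b \<inter> c) \<longleftrightarrow> \<pi> n \<in> a b \<and> \<pi> n \<in> a c"
    using p assms p' by (simp add: ultrafilter_iff eventually_conj_iff \<Psi>_in_clopen[symmetric])
qed

lemma code_disjoint: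
  assumes "clopenin X b" "clopenin X c" "b \<inter> c = {}"
  shows "\<forall>\<^sub>F n in cofinite. \<not> (\<pi> n \<in> a b \<and> \<pi> n \<in> a c)"
  unfolding eventually_iff_ultrafilters[of _ cofinite]
proof (intro allI impI)
  fix p :: "nat filter" assume p: "ultrafilter p \<and> p \<le> cofinite"
  then have p': "p \<in> topspace omega_star"
    by (simp add: topspace_omega_star_iff)
  have "\<not> (\<Psi> p \<in> b \<and> \<Psi> p \<in> c)"
    using assms(3) by blast
  then show "\<forall>\<^sub>F n in p. \<not> (\<pi> n \<in> a b \<and> \<pi> n \<in> a c)"
    using p assms p' by (simp only: ultrafilter_not eventually_conj_iff \<Psi>_in_clopen simp_thms)
qed

text \<open>
  Free ultrafilters cannot distinguish \<open>a (b \<inter> c)\<close> from \<open>a b \<inter> a c\<close>, so codes respect intersections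
  up to finite sets.
\<close>

lemma splitting_code:
  assumes "G \<le> cofinite"
  shows "splitting {\<pi> -` a b | b. clopenin X b \<and> b \<noteq> {}} G"
  unfolding splitting_def
proof (intro ballI)
  fix P P' assume "P \<in> {\<pi> -` a b | b. clopenin X b \<and> b \<noteq> {}}" "P' \<in> {\<pi> -` a b | b. clopenin X b \<and> b \<noteq> {}}"
  then obtain b b' where b: "clopenin X b" "P = \<pi> -` a b"
    and b': "clopenin X b'" "b' \<noteq> {}" "P' = \<pi> -` a b'"
    by blast
  show "\<exists>P''\<in>{\<pi> -` a b | b. clopenin X b \<and> b \<noteq> {}}.
      (\<forall>\<^sub>F n in G. n \<in> P'' \<longrightarrow> n \<in> P' \<and> n \<in> P) \<or> (\<forall>\<^sub>F n in G. n \<in> P'' \<longrightarrow> n \<in> P' \<and> n \<notin> P)"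
  proof (cases "b' \<inter> b = {}")
    case True
    have "\<forall>\<^sub>F n in G. n \<in> P' \<longrightarrow> n \<in> P' \<and> n \<notin> P"
      using filter_leD[OF assms code_disjoint[OF b'(1) b(1) True]]
      by (rule eventually_mono) (auto simp: b b')
    then show ?thesis using b' by blast
  next
    case False
    have "\<forall>\<^sub>F n in G. n \<in> \<pi> -` a (b' \<inter> b) \<longrightarrow> n \<in> P' \<and> n \<in> P"
      using filter_leD[OF assms code_Int[OF b'(1) b(1)]]
      by (rule eventually_mono) (auto simp: b b')
    moreover have "clopenin X (b' \<inter> b)"
      using b b' by auto
    ultimately show ?thesis using False by blast
  qed
qed

end

section \<open>Maximal filters over the image\<close>

text \<open>
  The third assumption is maximality of \<open>F\<close> among the filters with the second property: a set that
  is not in \<open>F\<close> is null on the code of some nonempty clopen set, so it can never be added.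
\<close>

locale maximal_coded_filter = coded_image +
  fixes F :: "nat filter"
  assumes free: "F \<le> cofinite"
    and positive: "\<And>b. clopenin X b \<Longrightarrow> b \<noteq> {} \<Longrightarrow> \<exists>\<^sub>F n in F. \<pi> n \<in> a b"
    and maximal: "\<And>A. (\<forall>\<^sub>F n in F. n \<in> A) \<or>
      (\<exists>b. clopenin X b \<and> b \<noteq> {} \<and> (\<forall>\<^sub>F n in F. \<not> (\<pi> n \<in> a b \<and> n \<in> A)))"
begin

lemma K_set_D:
  assumes "p \<in> K_set F"
  shows "ultrafilter p" "p \<in> topspace omega_star" "eventually P F \<Longrightarrow> eventually P p"
  using assms free by (auto simp: K_set_iff topspace_omega_star_iff intro: filter_leD)

lemma K_set_meets:
  assumes "clopenin X b" "b \<noteq> {}"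
  shows "\<exists>p\<in>K_set F. \<Psi> p \<in> b"
proof -
  obtain p where "ultrafilter p" "p \<le> F" "\<forall>\<^sub>F n in p. \<pi> n \<in> a b"
    using ultrafilter_below_frequently[OF positive[OF assms]] by blast
  then show ?thesis
    using assms(1) K_set_D(2) \<Psi>_in_clopen by (auto simp: K_set_iff)
qed

text \<open>
  Maximality as seen by the points of \<open>K_set F\<close>: a property that is given by a set and fails
  somewhere on \<open>K_set F\<close> fails on the whole preimage of some nonempty clopen set. This is
  irreducibility of \<open>\<Psi>\<close>.
\<close>

lemma K_set_avoidance:
  assumes eq: "\<And>p. p \<in> K_set F \<Longrightarrow> (\<forall>\<^sub>F n in p. n \<in> A) \<longleftrightarrow> Q p"
    and p: "p \<in> K_set F" "\<not> Q p"
  obtains b where "clopenin X b" "b \<noteq> {}" "\<And>p. p \<in> K_set F \<Longrightarrow> \<Psi> p \<in> b \<Longrightarrow> \<not> Q p"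
proof -
  have "\<not> (\<forall>\<^sub>F n in F. n \<in> A)"
    using K_set_D(3)[OF p(1)] eq[OF p(1)] p(2) by blast
  then obtain b where b: "clopenin X b" "b \<noteq> {}" "\<forall>\<^sub>F n in F. \<not> (\<pi> n \<in> a b \<and> n \<in> A)"
    using maximal[of A] by blast
  have "\<not> (\<Psi> p \<in> b \<and> Q p)" if p: "p \<in> K_set F" for p
  proof -
    have "\<not> ((\<forall>\<^sub>F n in p. \<pi> n \<in> a b) \<and> (\<forall>\<^sub>F n in p. n \<in> A))"
      using K_set_D(3)[OF p b(3)]
      unfolding ultrafilter_not[OF K_set_D(1)[OF p]] eventually_conj_iff .
    then show ?thesis
      unfolding \<Psi>_in_clopen[OF b(1) K_set_D(2)[OF p]] eq[OF p] .
  qed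
  then show ?thesis
    by (intro that[OF b(1,2)]) blast
qed

text \<open>
  Extremal disconnectedness enters here: the closure \<open>c\<close> of the union of all clopen \<open>b\<close> with preimage
  inside \<open>A\<close> is clopen. If \<open>c\<close> were wrong anywhere on \<open>K_set F\<close>, irreducibility would make it wrong on
  the preimage of a whole nonempty clopen \<open>b\<close>, but such a \<open>b\<close> either meets a member of the union or is
  one itself.
\<close>

lemma every_set_coded:
  "\<exists>c. clopenin X c \<and> (\<forall>p\<in>K_set F. (\<forall>\<^sub>F n in p. n \<in> A) \<longleftrightarrow> \<Psi> p \<in> c)"
proof -
  let ?W = "{b. clopenin X b \<and> (\<forall>p\<in>K_set F. \<Psi> p \<in> b \<longrightarrow> (\<forall>\<^sub>F n in p. n \<in> A))}"
  define c where "c = X closure_of (\<Union>?W)"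
  have W_open: "openin X (\<Union>?W)"
    by (rule openin_Union) auto
  then have c: "clopenin X c"
    using ed by (simp add: extremally_disconnected_space_def c_def)
  have W_c: "\<Union>?W \<subseteq> c"
    unfolding c_def by (rule closure_of_subset[OF openin_subset[OF W_open]])
  have "\<Psi> p \<in> c \<longrightarrow> (\<forall>\<^sub>F n in p. n \<in> A)" if p: "p \<in> K_set F" for p
  proof (rule ccontr)
    assume not: "\<not> (\<Psi> p \<in> c \<longrightarrow> (\<forall>\<^sub>F n in p. n \<in> A))"
    have eq: "(\<forall>\<^sub>F n in q. n \<in> {n. \<pi> n \<in> a c \<longrightarrow> n \<in> A}) \<longleftrightarrow> (\<Psi> q \<in> c \<longrightarrow> (\<forall>\<^sub>F n in q. n \<in> A))"
      if "q \<in> K_set F" for q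
      using c K_set_D(1,2)[OF that] by (simp add: ultrafilter_imp \<Psi>_in_clopen)
    obtain b where b: "clopenin X b" "b \<noteq> {}"
      "\<And>q. q \<in> K_set F \<Longrightarrow> \<Psi> q \<in> b \<Longrightarrow> \<not> (\<Psi> q \<in> c \<longrightarrow> (\<forall>\<^sub>F n in q. n \<in> A))"
      by (rule K_set_avoidance[OF eq p not]) (assumption, rule that)
    have "clopenin X (b - c)"
      using b(1) c by auto
    then have "b \<subseteq> c"
      using K_set_meets[of "b - c"] b(3) by blast
    then obtain d where d: "d \<in> ?W" "b \<inter> d \<noteq> {}"
      using b(1,2) openin_Int_closure_of_eq_empty[of X b "\<Union>?W"] unfolding c_def by blast
    then have "clopenin X (b \<inter> d)"
      using b(1) by auto
    then obtain q where "q \<in> K_set F" "\<Psi> q \<in> b \<inter> d"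
      using K_set_meets d(2) by blast
    then show False
      using b(3) d(1) by blast
  qed
  moreover have "(\<forall>\<^sub>F n in p. n \<in> A) \<longrightarrow> \<Psi> p \<in> c" if p: "p \<in> K_set F" for p
  proof (rule ccontr)
    assume not: "\<not> ((\<forall>\<^sub>F n in p. n \<in> A) \<longrightarrow> \<Psi> p \<in> c)"
    have eq: "(\<forall>\<^sub>F n in q. n \<in> {n. n \<in> A \<longrightarrow> \<pi> n \<in> a c}) \<longleftrightarrow> ((\<forall>\<^sub>F n in q. n \<in> A) \<longrightarrow> \<Psi> q \<in> c)"
      if "q \<in> K_set F" for q
      using c K_set_D(1,2)[OF that] by (simp add: ultrafilter_imp \<Psi>_in_clopen)
    obtain b where b: "clopenin X b" "b \<noteq> {}"
      "\<And>q. q \<in> K_set F \<Longrightarrow> \<Psi> q \<in> b \<Longrightarrow> \<not> ((\<forall>\<^sub>F n in q. n \<in> A) \<longrightarrow> \<Psi> q \<in> c)"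
      by (rule K_set_avoidance[OF eq p not]) (assumption, rule that)
    then have "b \<in> ?W" by blast
    then have "b \<subseteq> c" using W_c by blast
    then show False
      using K_set_meets[OF b(1,2)] b(3) by blast
  qed
  ultimately show ?thesis using c by blast
qed

lemma inj_on_\<Psi>: "inj_on \<Psi> (K_set F)"
proof (rule inj_onI)
  fix p q assume pq: "p \<in> K_set F" "q \<in> K_set F" "\<Psi> p = \<Psi> q"
  show "p = q"
  proof (rule ultrafilter_eqI)
    show "(\<forall>\<^sub>F n in p. n \<in> A) \<longleftrightarrow> (\<forall>\<^sub>F n in q. n \<in> A)" for A
      using every_set_coded[of A] pq by metis
  qed (use pq K_set_D in auto)
qed

text \<open>
  The preimages of the clopen neighbourhoods of \<open>x\<close> generate, together with \<open>F\<close>, a proper filter, and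
  an ultrafilter above it can only be mapped to \<open>x\<close>.
\<close>

lemma \<Psi>_onto: "\<Psi> ` K_set F = topspace X"
proof (intro equalityI subsetI)
  fix x assume x: "x \<in> topspace X"
  let ?N = "{b. clopenin X b \<and> x \<in> b}"
  let ?G = "inf F (INF b\<in>?N. principal {n. \<pi> n \<in> a b})"
  have "?G \<noteq> bot"
  proof
    assume "?G = bot"
    then have "eventually (\<lambda>_. False) ?G" by simp
    then obtain J where J: "finite J" "J \<subseteq> ?N" "\<forall>\<^sub>F n in F. (\<forall>b\<in>J. n \<in> {n. \<pi> n \<in> a b}) \<longrightarrow> False"
      by (rule eventually_inf_INF_principal)
    let ?b = "topspace X \<inter> \<Inter>J"
    have "clopenin X ?b"
      using J(1,2)
    proof (induction rule: finite_induct)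
      case (insert b J)
      have "topspace X \<inter> \<Inter>(insert b J) = b \<inter> (topspace X \<inter> \<Inter>J)"
        by auto
      with insert show ?case by auto
    qed simp
    moreover have "?b \<noteq> {}"
      using x J(2) by blast
    ultimately obtain p where p: "p \<in> K_set F" "\<Psi> p \<in> ?b"
      using K_set_meets by blast
    have "\<forall>\<^sub>F n in p. \<pi> n \<in> a b" if "b \<in> J" for b
      using p that J(2) K_set_D(2)[OF p(1)] \<Psi>_in_clopen[of b p] by auto
    then have "\<forall>\<^sub>F n in p. \<forall>b\<in>J. \<pi> n \<in> a b"
      using J(1) by (simp add: eventually_ball_finite)
    with K_set_D(3)[OF p(1) J(3)] have "\<forall>\<^sub>F n in p. False"
      by eventually_elim simp
    then show False
      using K_set_D(1)[OF p(1)] by (simp add: ultrafilter_def trivial_limit_def)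
  qed
  then obtain p where p: "ultrafilter p" "p \<le> ?G"
    using ultrafilter_below by blast
  then have pK: "p \<in> K_set F"
    by (simp add: K_set_iff)
  have in_b: "\<Psi> p \<in> b" if "clopenin X b" "x \<in> b" for b
  proof -
    have "p \<le> principal {n. \<pi> n \<in> a b}"
      using p(2) that by (simp add: le_INF_iff)
    then show ?thesis
      using \<Psi>_in_clopen[OF that(1) K_set_D(2)[OF pK]] by (simp add: le_principal)
  qed
  have "\<Psi> p = x"
  proof (rule ccontr)
    assume "\<Psi> p \<noteq> x"
    then obtain U where U: "openin X U" "x \<in> U" "\<Psi> p \<notin> U"
      using Hausdorff x \<Psi>_in_topspace[OF K_set_D(2)[OF pK]] unfolding Hausdorff_space_def disjnt_def
      by (metis IntI empty_iff)
    obtain b where "clopenin X b" "x \<in> b" "b \<subseteq> U"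
      using clopen_base_of_extremally_disconnected[OF Hausdorff compact ed U(1,2)] by blast
    with in_b U(3) show False by blast
  qed
  then show "x \<in> \<Psi> ` K_set F" using pK by blast
qed (use \<Psi>_in_topspace K_set_D in auto)

text \<open>
  The map \<open>\<Psi>\<close> is open on \<open>K_set F\<close> because a basic open set, given by \<open>A\<close>, has a clopen set as its
  image, namely the one that codes \<open>A\<close>.
\<close>

lemma K_set_homeomorphic: "subtopology omega_star (K_set F) homeomorphic_space X"
proof -
  let ?K = "subtopology omega_star (K_set F)"
  have top: "topspace ?K = K_set F"
    using K_set_D(2) by auto
  have "homeomorphic_map ?K X \<Psi>"
  proof (rule bijective_open_imp_homeomorphic_map)
    show "continuous_map ?K X \<Psi>"
      by (rule continuous_map_from_subtopology[OF continuous_\<Psi>])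
    show "open_map ?K X \<Psi>"
      unfolding open_map_def
    proof (intro allI impI)
      fix V assume "openin ?K V"
      then obtain U where U: "openin omega_star U" "V = U \<inter> K_set F"
        by (auto simp: openin_subtopology)
      have "\<exists>b. openin X b \<and> y \<in> b \<and> b \<subseteq> \<Psi> ` V" if y: "y \<in> \<Psi> ` V" for y
      proof -
        obtain p where p: "p \<in> V" "y = \<Psi> p"
          using y by blast
        obtain A where A: "\<forall>\<^sub>F n in p. n \<in> A"
          "\<And>q. q \<in> topspace omega_star \<Longrightarrow> \<forall>\<^sub>F n in q. n \<in> A \<Longrightarrow> q \<in> U"
          using U p(1) unfolding openin_omega_star by blast
        obtain c where c: "clopenin X c" "\<forall>q\<in>K_set F. (\<forall>\<^sub>F n in q. n \<in> A) \<longleftrightarrow> \<Psi> q \<in> c"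
          using every_set_coded[of A] by blast
        have "z \<in> \<Psi> ` V" if z: "z \<in> c" for z
        proof -
          obtain q where q: "q \<in> K_set F" "z = \<Psi> q"
            using z c(1) \<Psi>_onto openin_subset by (metis imageE subsetD)
          then have "q \<in> V"
            using z c(2) A(1,2) K_set_D(2) U(2) by blast
          with q(2) show ?thesis by blast
        qed
        moreover have "y \<in> c"
          using p A(1) c(2) U(2) by blast
        ultimately show ?thesis using c(1) by blast
      qed
      then show "openin X (\<Psi> ` V)"
        using openin_subopen by metis
    qed
    show "\<Psi> ` topspace ?K = topspace X" "inj_on \<Psi> (topspace ?K)"
      unfolding top by (rule \<Psi>_onto, rule inj_on_\<Psi>)
  qed
  then show ?thesis
    using homeomorphic_map_imp_homeomorphic_space by blast
qed

text \<open>
  As \<open>M\<close> belongs to \<open>q\<close> and to its image, \<open>f\<close> preserves blocks on a member of \<open>q\<close>. Since \<open>\<Psi>\<close> depends on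
  blocks only, it takes the same value at both points.
\<close>

lemma K_set_self_map_identity:
  assumes q: "q \<in> K_set F" "filtermap f q \<in> K_set F"
    and same: "\<And>n. n \<in> M \<Longrightarrow> f n \<in> M \<Longrightarrow> \<pi> (f n) = \<pi> n" and M: "\<forall>\<^sub>F n in F. n \<in> M"
  shows "filtermap f q = q"
proof -
  have "\<forall>\<^sub>F n in q. n \<in> M" "\<forall>\<^sub>F n in q. f n \<in> M"
    using K_set_D(3)[OF q(1) M] K_set_D(3)[OF q(2) M] by (simp_all add: eventually_filtermap)
  then have *: "\<forall>\<^sub>F n in q. \<pi> (f n) = \<pi> n"
    by eventually_elim (rule same)
  have "eventually P (filtermap \<pi> (filtermap f q)) \<longleftrightarrow> eventually P (filtermap \<pi> q)" for P
    unfolding eventually_filtermap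
    by (rule eventually_subst) (use * in \<open>auto elim: eventually_mono\<close>)
  then have "filtermap \<pi> (filtermap f q) = filtermap \<pi> q"
    by (rule filter_eqI)
  then have "\<Psi> (filtermap f q) = \<Psi> q"
    by (simp add: \<Psi>_def)
  then show ?thesis
    using inj_on_\<Psi> q by (auto dest: inj_onD)
qed

lemma nontrivial: "F \<noteq> bot"
proof
  assume "F = bot"
  have "topspace omega_star \<noteq> {}"
  proof -
    have "(cofinite :: nat filter) \<noteq> bot"
      by (simp add: trivial_limit_def eventually_cofinite)
    then show ?thesis
      using ultrafilter_below[of "cofinite :: nat filter"] topspace_omega_star_iff by blast
  qed
  then have "topspace X \<noteq> {}"
    using onto by blast
  with positive[of "topspace X"] \<open>F = bot\<close> show False
    by (simp add: frequently_def)
qed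

text \<open>
  A continuous bijection of \<open>\<xi>(F)\<close> fixes the only point that is not isolated, and on \<open>\<omega>\<close> it is a
  permutation that maps \<open>K_set F\<close> into itself. It therefore fixes \<open>K_set F\<close> pointwise, so it carries
  members of \<open>F\<close> to members of \<open>F\<close>.
\<close>

lemma reversible_filter_F:
  assumes rising: "\<And>f. bij f \<Longrightarrow> \<forall>\<^sub>F n in F. n \<in> block_rising \<pi> f"
  shows "reversible_filter F"
  unfolding reversible_filter_def reversible_space_def topspace_xi
proof (intro allI impI, elim conjE)
  fix g :: "nat option \<Rightarrow> nat option"
  assume g: "continuous_map (xi F) (xi F) g" and bij: "bij g"
  have preimage: "openin (xi F) {x. g x \<in> U}" if "openin (xi F) U" for U
    using openin_continuous_map_preimage[OF g that] by (simp add: topspace_xi)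
  have g_None: "g None = None"
  proof (rule ccontr)
    assume "g None \<noteq> None"
    then obtain m where m: "g None = Some m" by blast
    then have "{x. g x \<in> {Some m}} = {None}"
      using bij by (auto simp: bij_def inj_def)
    moreover have "openin (xi F) {Some m}"
      by (simp add: openin_xi)
    ultimately have "openin (xi F) {None}"
      using preimage by metis
    then show False
      using nontrivial by (simp add: openin_xi trivial_limit_def)
  qed
  define f where "f n = the (g (Some n))" for n
  have g_Some: "g (Some n) = Some (f n)" for n
  proof -
    have "g (Some n) \<noteq> None"
      using bij g_None by (metis bij_is_inj injD option.distinct(1))
    then show ?thesis by (auto simp: f_def)
  qed
  have "bij f"
  proof (rule bijI)
    show "inj f"
      using bij g_Some by (metis bij_is_inj injD injI option.inject)
    show "surj f"
    proof (rule surjI[of _ "\<lambda>n. the (inv g (Some n))"])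
      fix n
      have *: "g (inv g (Some n)) = Some n"
        using bij by (simp add: bij_is_surj surj_f_inv_f)
      then obtain m where "inv g (Some n) = Some m"
        using g_None by (cases "inv g (Some n)") auto
      with * g_Some show "f (the (inv g (Some n))) = n"
        by simp
    qed
  qed
  have pull: "\<forall>\<^sub>F n in F. P (f n)" if "eventually P F" for P
  proof -
    have "openin (xi F) {x. \<forall>n. x = Some n \<longrightarrow> P n}"
      using that by (simp add: openin_xi)
    from preimage[OF this] show ?thesis
      by (simp add: openin_xi g_None g_Some)
  qed
  have fixed: "filtermap f q = q" if q: "q \<in> K_set F" for q
  proof (rule K_set_self_map_identity[OF q])
    have "filtermap f q \<le> F"
      using q pull by (auto simp: le_filter_def eventually_filtermap K_set_iff)
    then show "filtermap f q \<in> K_set F"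
      using q by (simp add: K_set_iff ultrafilter_filtermap)
    show "\<pi> (f n) = \<pi> n" if "n \<in> block_rising \<pi> f" "f n \<in> block_rising \<pi> f" for n
      using block_rising_preserves_block[OF \<open>bij f\<close> that] .
    show "\<forall>\<^sub>F n in F. n \<in> block_rising \<pi> f"
      using rising[OF \<open>bij f\<close>] .
  qed
  show "homeomorphic_map (xi F) (xi F) g"
  proof (rule bijective_open_imp_homeomorphic_map[OF g])
    show "open_map (xi F) (xi F) g"
      unfolding open_map_def
    proof (intro allI impI)
      fix U assume U: "openin (xi F) U"
      show "openin (xi F) (g ` U)"
        unfolding openin_xi
      proof
        assume "None \<in> g ` U"
        then have "None \<in> U"
          using g_None bij by (metis bij_is_inj imageE injD)
        then have ev: "\<forall>\<^sub>F n in F. Some n \<in> U"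
          using U by (simp add: openin_xi)
        show "\<forall>\<^sub>F n in F. Some n \<in> g ` U"
          unfolding eventually_iff_ultrafilters[of _ F]
        proof (intro allI impI)
          fix q assume "ultrafilter q \<and> q \<le> F"
          then have q: "q \<in> K_set F"
            by (simp add: K_set_iff)
          have "\<forall>\<^sub>F n in q. Some (f n) \<in> g ` U"
            using K_set_D(3)[OF q ev]
            by (rule eventually_mono) (simp add: g_Some[symmetric])
          then have "\<forall>\<^sub>F n in filtermap f q. Some n \<in> g ` U"
            by (simp add: eventually_filtermap)
          then show "\<forall>\<^sub>F n in q. Some n \<in> g ` U"
            by (simp add: fixed[OF q])
        qed
      qed
    qed
  qed (use bij in \<open>auto simp: topspace_xi bij_def\<close>)
qed

end

section \<open>The embedding theorem\<close>

theorem theorem4p4: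
  fixes X :: "'a topology"
  assumes "Hausdorff_space X"
    and "compact_space X"
    and "extremally_disconnected_space X"
    and "\<exists>f. continuous_map omega_star X f \<and> f ` topspace omega_star = topspace X"
  shows "\<exists>F :: nat filter. F \<le> cofinite \<and> reversible_filter F \<and>
           weak_P_set omega_star (K_set F) \<and>
           subtopology omega_star (K_set F) homeomorphic_space X"
proof -
  obtain \<phi> where \<phi>: "continuous_map omega_star X \<phi>" "\<phi> ` topspace omega_star = topspace X"
    using assms(4) by blast
  have "\<exists>A. \<forall>p\<in>topspace omega_star. \<phi> p \<in> b \<longleftrightarrow> (\<forall>\<^sub>F n in p. n \<in> A)" if "clopenin X b" for b
  proof -
    have "clopenin omega_star {p \<in> topspace omega_star. \<phi> p \<in> b}"
      using that \<phi>(1) openin_continuous_map_preimage closedin_continuous_map_preimage by blast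
    from clopenin_omega_star_coded[OF this] show ?thesis by simp
  qed
  then obtain a where a: "\<And>b p. clopenin X b \<Longrightarrow> p \<in> topspace omega_star \<Longrightarrow>
      \<phi> p \<in> b \<longleftrightarrow> (\<forall>\<^sub>F n in p. n \<in> a b)"
    by metis
  obtain \<pi> :: "nat \<Rightarrow> nat" and A :: "nat set \<Rightarrow> nat set \<Rightarrow> nat \<Rightarrow> nat set"
    where \<pi>: "\<And>k. finite {n. \<pi> n < k}"
      and A_mono: "\<And>i y m. A i y m \<subseteq> A i y (Suc m)"
      and A_linked: "\<And>i Y m. card Y = Suc m \<Longrightarrow> finite {n. \<forall>y\<in>Y. n \<in> A i y m}"
      and A_large: "\<And>Z. Z \<in> cells A UNIV \<Longrightarrow>
           \<forall>\<^sub>F k in sequentially. 2 * k * card {n. \<pi> n < k} < card {n \<in> Z. \<pi> n = k}"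
    by (rule linked_matrix_exists) (rule that)
  interpret coded_image X \<phi> a \<pi>
    by unfold_locales (use assms \<phi> a \<pi> in auto)
  define Q where "Q = {\<pi> -` a b | b. clopenin X b \<and> b \<noteq> {}}"
  have block_free: "block_filter \<pi> \<le> cofinite"
    by (simp add: block_filter_def)
  have ind: "cell_independent A Q (block_filter \<pi>) UNIV"
  proof (rule cell_independent_block_filter[OF \<pi> A_large])
    show "\<exists>S. infinite S \<and> P = \<pi> -` S" if "P \<in> Q" for P
      using that infinite_code unfolding Q_def by blast
  qed
  have spl: "splitting Q (block_filter \<pi>)"
    unfolding Q_def by (rule splitting_code[OF block_free])
  \<comment> \<open>Rows are sets of natural numbers; read as sets of pairs, they enumerate all decreasing sequences.\<close>
  define C :: "nat set \<Rightarrow> nat \<Rightarrow> nat set" where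
    "C t k = {n. \<forall>j\<le>k. prod_encode (j, n) \<in> t}" for t k
  have C_dec: "decseq (C t)" for t
    by (auto simp: C_def decseq_def)
  have C_onto: "\<exists>t. C t = D" if "decseq D" for D
  proof
    show "C {prod_encode (j, n) | j n. n \<in> D j} = D"
      using decseqD[OF that] by (fastforce simp: C_def)
  qed
  have inf: "infinite (UNIV :: nat set set)"
    using uncountable_nat_sets countable_finite by blast
  obtain F where F: "F \<le> block_filter \<pi>" "\<And>P. P \<in> Q \<Longrightarrow> \<exists>\<^sub>F n in F. n \<in> P"
    "\<And>t. settled TYPE(nat set) Q (C t) F"
    by (rule settling_filter_exists[OF A_mono A_linked ind spl inf C_dec]) (assumption, rule that)
  have settled_F: "settled TYPE(nat set) Q D F" if "decseq D" for D
    using F(3) C_onto[OF that] by metis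
  have free: "F \<le> cofinite"
    using F(1) block_free by (rule order_trans)
  interpret maximal_coded_filter X \<phi> a \<pi> F
  proof
    show "\<exists>\<^sub>F n in F. \<pi> n \<in> a b" if "clopenin X b" "b \<noteq> {}" for b
      using F(2)[of "\<pi> -` a b"] that by (auto simp: Q_def)
    show "(\<forall>\<^sub>F n in F. n \<in> B) \<or>
        (\<exists>b. clopenin X b \<and> b \<noteq> {} \<and> (\<forall>\<^sub>F n in F. \<not> (\<pi> n \<in> a b \<and> n \<in> B)))" for B
      using settled_F[of "\<lambda>_. B"] unfolding settled_def Q_def by (auto simp: decseq_def)
  qed (rule free)
  have "weak_P_set omega_star (K_set F)"
  proof (rule weak_P_set_K_set[OF free uncountable_nat_sets])
    fix D :: "nat \<Rightarrow> nat set"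
    assume D: "decseq D" "\<And>k. \<forall>\<^sub>F n in F. n \<in> D k"
    have "\<not> (\<forall>\<^sub>F n in F. \<not> (n \<in> P \<and> n \<in> D k))" if "P \<in> Q" for P k
    proof
      assume "\<forall>\<^sub>F n in F. \<not> (n \<in> P \<and> n \<in> D k)"
      then have "\<forall>\<^sub>F n in F. n \<notin> P"
        using D(2)[of k] by eventually_elim blast
      with F(2)[OF that] show False
        by (simp add: frequently_def)
    qed
    then show "\<exists>V :: nat set \<Rightarrow> nat set. (\<forall>y. \<forall>\<^sub>F n in F. n \<in> V y) \<and>
        (\<forall>Y k. card Y = Suc k \<longrightarrow> finite {n. (\<forall>y\<in>Y. n \<in> V y) \<and> n \<notin> D k})"
      using settled_F[OF D(1)] unfolding settled_def by blast
  qed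
  moreover have "reversible_filter F"
    by (rule reversible_filter_F) (rule filter_leD[OF F(1) eventually_block_rising])
  ultimately show ?thesis
    using free K_set_homeomorphic by blast
qed

end
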